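(* Let $\alpha\in\mathrm{Aut}(\mathcal{O}_2)$ be a Bogoljubov automorphism. Then $\alpha$ extends to an endomorphism of $\mathcal{Q}_2$ if and only if $\alpha$ is the flip-flop, a gauge automorphism, or a composition of these two.
   Context: The $2$-adic ring $C^*$-algebra $\mathcal{Q}_2$ is the universal (unital) $C^*$-algebra generated by a unitary $U$ and an isometry $S_2$ satisfying $S_2U=U^2S_2$ and $S_2S_2^*+US_2S_2^*U^*=1$. Put $S_1:=US_2$. The Cuntz algebra $\mathcal{O}_2$ is regarded as the $C^*$-subalgebra $C^*(S_1,S_2)\subset\mathcal{Q}_2$. All endomorphisms are unital and $*$-preserving. The Bogoljubov automorphisms of $\mathcal{O}_2$ are the automorphisms $\lambda_A$ determined by $\lambda_A(S_1)=aS_1+cS_2$ and $\lambda_A(S_2)=bS_1+dS_2$, where $A=\begin{pmatrix}a&b\\c&d\end{pmatrix}$ is a unitary $2\times 2$ complex matrix. The flip-flop is the automorphism of $\mathcal{O}_2$ that exchanges $S_1$ and $S_2$. The gauge automorphisms are the automorphisms $\alpha_z$, for $z\in\mathbb{T}$ (complex numbers of modulus one), determined by $\alpha_z(S_i)=zS_i$, $i=1,2$. *)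

theory Defs
  imports "HOL-Analysis.Analysis" "HOL-Algebra.Module"
begin

section \<open>Unital C*-algebras\<close>

record 'a cstar = "(complex, 'a) module" +
  adj :: "'a \<Rightarrow> 'a" (\<open>_\<^sup>\<star>\<index>\<close> [1000] 999)
  nrm :: "'a \<Rightarrow> real" (\<open>\<parallel>_\<parallel>\<index>\<close>)

definition cstar_tendsto :: "('a, 'm) cstar_scheme \<Rightarrow> (nat \<Rightarrow> 'a) \<Rightarrow> 'a \<Rightarrow> bool" where
  "cstar_tendsto A \<sigma> l \<longleftrightarrow> (\<lambda>n. \<parallel>\<sigma> n \<ominus>\<^bsub>A\<^esub> l\<parallel>\<^bsub>A\<^esub>) \<longlonglongrightarrow> 0"

definition cstar_Cauchy :: "('a, 'm) cstar_scheme \<Rightarrow> (nat \<Rightarrow> 'a) \<Rightarrow> bool" where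
  "cstar_Cauchy A \<sigma> \<longleftrightarrow>
     (\<forall>e>0. \<exists>N. \<forall>m\<ge>N. \<forall>n\<ge>N. \<parallel>\<sigma> m \<ominus>\<^bsub>A\<^esub> \<sigma> n\<parallel>\<^bsub>A\<^esub> < e)"

locale cstar_algebra = ring A for A (structure) +
  assumes smult_closed: "x \<in> carrier A \<Longrightarrow> a \<odot> x \<in> carrier A"
    and smult_l_distr: "x \<in> carrier A \<Longrightarrow> (a + b) \<odot> x = a \<odot> x \<oplus> b \<odot> x"
    and smult_r_distr:
      "\<lbrakk>x \<in> carrier A; y \<in> carrier A\<rbrakk> \<Longrightarrow> a \<odot> (x \<oplus> y) = a \<odot> x \<oplus> a \<odot> y"
    and smult_assoc: "x \<in> carrier A \<Longrightarrow> (a * b) \<odot> x = a \<odot> (b \<odot> x)"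
    and smult_one: "x \<in> carrier A \<Longrightarrow> 1 \<odot> x = x"
    and smult_mult_l:
      "\<lbrakk>x \<in> carrier A; y \<in> carrier A\<rbrakk> \<Longrightarrow> (a \<odot> x) \<otimes> y = a \<odot> (x \<otimes> y)"
    and smult_mult_r:
      "\<lbrakk>x \<in> carrier A; y \<in> carrier A\<rbrakk> \<Longrightarrow> x \<otimes> (a \<odot> y) = a \<odot> (x \<otimes> y)"
    and adj_closed: "x \<in> carrier A \<Longrightarrow> x\<^sup>\<star> \<in> carrier A"
    and adj_adj: "x \<in> carrier A \<Longrightarrow> (x\<^sup>\<star>)\<^sup>\<star> = x"
    and adj_add: "\<lbrakk>x \<in> carrier A; y \<in> carrier A\<rbrakk> \<Longrightarrow> (x \<oplus> y)\<^sup>\<star> = x\<^sup>\<star> \<oplus> y\<^sup>\<star>"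
    and adj_smult: "x \<in> carrier A \<Longrightarrow> (a \<odot> x)\<^sup>\<star> = cnj a \<odot> x\<^sup>\<star>"
    and adj_mult: "\<lbrakk>x \<in> carrier A; y \<in> carrier A\<rbrakk> \<Longrightarrow> (x \<otimes> y)\<^sup>\<star> = y\<^sup>\<star> \<otimes> x\<^sup>\<star>"
    and nrm_nonneg: "x \<in> carrier A \<Longrightarrow> 0 \<le> \<parallel>x\<parallel>"
    and nrm_eq_0: "x \<in> carrier A \<Longrightarrow> \<parallel>x\<parallel> = 0 \<longleftrightarrow> x = \<zero>"
    and nrm_triangle: "\<lbrakk>x \<in> carrier A; y \<in> carrier A\<rbrakk> \<Longrightarrow> \<parallel>x \<oplus> y\<parallel> \<le> \<parallel>x\<parallel> + \<parallel>y\<parallel>"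
    and nrm_smult: "x \<in> carrier A \<Longrightarrow> \<parallel>a \<odot> x\<parallel> = cmod a * \<parallel>x\<parallel>"
    and nrm_mult: "\<lbrakk>x \<in> carrier A; y \<in> carrier A\<rbrakk> \<Longrightarrow> \<parallel>x \<otimes> y\<parallel> \<le> \<parallel>x\<parallel> * \<parallel>y\<parallel>"
    and cstar_identity: "x \<in> carrier A \<Longrightarrow> \<parallel>x\<^sup>\<star> \<otimes> x\<parallel> = \<parallel>x\<parallel>\<^sup>2"
    and complete:
      "\<lbrakk>\<And>n. \<sigma> n \<in> carrier A; cstar_Cauchy A \<sigma>\<rbrakk> \<Longrightarrow> \<exists>l\<in>carrier A. cstar_tendsto A \<sigma> l"

text \<open>Unital *-homomorphisms; preservation of the unit is part of \<^const>\<open>ring_hom\<close>.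
  Only the values on the carrier matter.\<close>

definition star_hom :: "('a, 'm) cstar_scheme \<Rightarrow> ('b, 'n) cstar_scheme \<Rightarrow> ('a \<Rightarrow> 'b) set" where
  "star_hom A B = {\<phi> \<in> ring_hom A B.
     (\<forall>a. \<forall>x\<in>carrier A. \<phi> (a \<odot>\<^bsub>A\<^esub> x) = a \<odot>\<^bsub>B\<^esub> \<phi> x) \<and>
     (\<forall>x\<in>carrier A. \<phi> (x\<^sup>\<star>\<^bsub>A\<^esub>) = (\<phi> x)\<^sup>\<star>\<^bsub>B\<^esub>)}"

definition star_aut :: "('a, 'm) cstar_scheme \<Rightarrow> ('a \<Rightarrow> 'a) set" where
  "star_aut A = {\<phi> \<in> star_hom A A. bij_betw \<phi> (carrier A) (carrier A)}"

definition cstar_subalgebra :: "'a set \<Rightarrow> ('a, 'm) cstar_scheme \<Rightarrow> bool" where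
  "cstar_subalgebra H A \<longleftrightarrow> H \<subseteq> carrier A \<and> \<one>\<^bsub>A\<^esub> \<in> H \<and>
     (\<forall>x\<in>H. \<forall>y\<in>H. x \<oplus>\<^bsub>A\<^esub> y \<in> H \<and> x \<otimes>\<^bsub>A\<^esub> y \<in> H) \<and>
     (\<forall>a. \<forall>x\<in>H. a \<odot>\<^bsub>A\<^esub> x \<in> H) \<and> (\<forall>x\<in>H. x\<^sup>\<star>\<^bsub>A\<^esub> \<in> H) \<and>
     (\<forall>\<sigma>. \<forall>l\<in>carrier A. (\<forall>n. \<sigma> n \<in> H) \<and> cstar_tendsto A \<sigma> l \<longrightarrow> l \<in> H)"

definition cstar_generated :: "('a, 'm) cstar_scheme \<Rightarrow> 'a set \<Rightarrow> 'a set" where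
  "cstar_generated A X = \<Inter>{H. cstar_subalgebra H A \<and> X \<subseteq> H}"

section \<open>The 2-adic ring C*-algebra\<close>

definition two_adic_relations :: "('a, 'm) cstar_scheme \<Rightarrow> 'a \<Rightarrow> 'a \<Rightarrow> bool" where
  "two_adic_relations A U S \<longleftrightarrow> U \<in> carrier A \<and> S \<in> carrier A \<and>
     U\<^sup>\<star>\<^bsub>A\<^esub> \<otimes>\<^bsub>A\<^esub> U = \<one>\<^bsub>A\<^esub> \<and> U \<otimes>\<^bsub>A\<^esub> U\<^sup>\<star>\<^bsub>A\<^esub> = \<one>\<^bsub>A\<^esub> \<and>
     S\<^sup>\<star>\<^bsub>A\<^esub> \<otimes>\<^bsub>A\<^esub> S = \<one>\<^bsub>A\<^esub> \<and>
     S \<otimes>\<^bsub>A\<^esub> U = U [^]\<^bsub>A\<^esub> (2::nat) \<otimes>\<^bsub>A\<^esub> S \<and>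
     S \<otimes>\<^bsub>A\<^esub> S\<^sup>\<star>\<^bsub>A\<^esub> \<oplus>\<^bsub>A\<^esub> U \<otimes>\<^bsub>A\<^esub> S \<otimes>\<^bsub>A\<^esub> S\<^sup>\<star>\<^bsub>A\<^esub> \<otimes>\<^bsub>A\<^esub> U\<^sup>\<star>\<^bsub>A\<^esub> = \<one>\<^bsub>A\<^esub>"

text \<open>\<open>Q\<close> is generated by \<open>U\<close> and \<open>S\<close> and is universal for the relations.  HOL cannot quantify
  over all types inside a formula, so the test algebras \<open>B\<close> are those with carrier in one type of
  cardinality continuum.  This is no restriction: a C*-algebra generated by two elements has at
  most continuum many elements.  The lemma \<open>two_adic_ring_universal\<close> below derives
  the universal property for test algebras over an arbitrary type.\<close>

definition two_adic_ring_cstar :: "('a, 'm) cstar_scheme \<Rightarrow> 'a \<Rightarrow> 'a \<Rightarrow> bool" where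
  "two_adic_ring_cstar Q U S \<longleftrightarrow>
     cstar_algebra Q \<and> two_adic_relations Q U S \<and> cstar_generated Q {U, S} = carrier Q \<and>
     (\<forall>(B :: (nat \<Rightarrow> complex) cstar) u s. cstar_algebra B \<and> two_adic_relations B u s \<longrightarrow>
        (\<exists>\<phi>\<in>star_hom Q B. \<phi> U = u \<and> \<phi> S = s))"

definition cuntz_O2 :: "('a, 'm) cstar_scheme \<Rightarrow> 'a \<Rightarrow> 'a \<Rightarrow> ('a, 'm) cstar_scheme" where
  "cuntz_O2 Q U S = Q\<lparr>carrier := cstar_generated Q {U \<otimes>\<^bsub>Q\<^esub> S, S}\<rparr>"

section \<open>Automorphisms of the Cuntz algebra\<close>

definition unitary_matrix :: "complex ^ 'n ^ 'n \<Rightarrow> bool" where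
  "unitary_matrix M \<longleftrightarrow>
     map_matrix cnj (transpose M) ** M = mat 1 \<and> M ** map_matrix cnj (transpose M) = mat 1"

definition bogoljubov :: "('a, 'm) cstar_scheme \<Rightarrow> 'a \<Rightarrow> 'a \<Rightarrow> ('a \<Rightarrow> 'a) \<Rightarrow> bool" where
  "bogoljubov \<O> S1 S2 \<alpha> \<longleftrightarrow> \<alpha> \<in> star_aut \<O> \<and>
     (\<exists>M :: complex ^ 2 ^ 2. unitary_matrix M \<and>
        \<alpha> S1 = (M $ 1 $ 1) \<odot>\<^bsub>\<O>\<^esub> S1 \<oplus>\<^bsub>\<O>\<^esub> (M $ 2 $ 1) \<odot>\<^bsub>\<O>\<^esub> S2 \<and>
        \<alpha> S2 = (M $ 1 $ 2) \<odot>\<^bsub>\<O>\<^esub> S1 \<oplus>\<^bsub>\<O>\<^esub> (M $ 2 $ 2) \<odot>\<^bsub>\<O>\<^esub> S2)"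

definition flip_flop :: "('a, 'm) cstar_scheme \<Rightarrow> 'a \<Rightarrow> 'a \<Rightarrow> ('a \<Rightarrow> 'a) \<Rightarrow> bool" where
  "flip_flop \<O> S1 S2 \<alpha> \<longleftrightarrow> \<alpha> \<in> star_aut \<O> \<and> \<alpha> S1 = S2 \<and> \<alpha> S2 = S1"

definition gauge_aut :: "('a, 'm) cstar_scheme \<Rightarrow> 'a \<Rightarrow> 'a \<Rightarrow> ('a \<Rightarrow> 'a) \<Rightarrow> bool" where
  "gauge_aut \<O> S1 S2 \<alpha> \<longleftrightarrow> \<alpha> \<in> star_aut \<O> \<and>
     (\<exists>z. cmod z = 1 \<and> \<alpha> S1 = z \<odot>\<^bsub>\<O>\<^esub> S1 \<and> \<alpha> S2 = z \<odot>\<^bsub>\<O>\<^esub> S2)"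

section \<open>Universality over arbitrary types\<close>

context cstar_algebra
begin

lemma smult_zero_left: "x \<in> carrier A \<Longrightarrow> 0 \<odot> x = \<zero>"
  using smult_l_distr[of x 0 0] smult_closed[of x 0]
  by (metis add.l_cancel_one' add.r_cancel_one' add_0)

lemma a_inv_smult: "x \<in> carrier A \<Longrightarrow> \<ominus> x = (-1) \<odot> x"
proof -
  assume x: "x \<in> carrier A"
  have "(-1) \<odot> x \<oplus> x = (-1 + 1) \<odot> x"
    using x by (simp only: smult_l_distr smult_one)
  also have "\<dots> = \<zero>" using x smult_zero_left by simp
  finally show ?thesis using x smult_closed minus_equality by blast
qed

lemma nrm_minus_commute:
  assumes "x \<in> carrier A" "y \<in> carrier A"
  shows "\<parallel>x \<ominus> y\<parallel> = \<parallel>y \<ominus> x\<parallel>"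
proof -
  have "\<ominus> (x \<ominus> y) = y \<ominus> x"
    using assms by (simp add: a_minus_def minus_add a_comm)
  then have "y \<ominus> x = (-1) \<odot> (x \<ominus> y)"
    using assms a_inv_smult[of "x \<ominus> y"] by simp
  then show ?thesis using assms nrm_smult[of "x \<ominus> y" "-1"] by simp
qed

lemma nrm_minus_triangle:
  assumes "x \<in> carrier A" "y \<in> carrier A" "z \<in> carrier A"
  shows "\<parallel>x \<ominus> z\<parallel> \<le> \<parallel>x \<ominus> y\<parallel> + \<parallel>y \<ominus> z\<parallel>"
proof -
  have "(x \<ominus> y) \<oplus> (y \<ominus> z) = x \<oplus> ((\<ominus> y \<oplus> y) \<ominus> z)"
    using assms by (simp add: a_minus_def a_assoc del: l_neg r_neg)
  also have "\<dots> = x \<ominus> z" using assms by (simp add: l_neg a_minus_def)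
  finally have "x \<ominus> z = (x \<ominus> y) \<oplus> (y \<ominus> z)" by simp
  then show ?thesis using assms nrm_triangle[of "x \<ominus> y" "y \<ominus> z"] by simp
qed

lemma nrm_adj: "x \<in> carrier A \<Longrightarrow> \<parallel>x\<^sup>\<star>\<parallel> = \<parallel>x\<parallel>"
proof -
  have le: "\<parallel>y\<parallel> \<le> \<parallel>y\<^sup>\<star>\<parallel>" if y: "y \<in> carrier A" for y
  proof (cases "\<parallel>y\<parallel> = 0")
    case True then show ?thesis using nrm_nonneg[OF adj_closed[OF y]] by simp
  next
    case False
    then have pos: "0 < \<parallel>y\<parallel>" using nrm_nonneg[OF y] by simp
    have "\<parallel>y\<parallel> * \<parallel>y\<parallel> \<le> \<parallel>y\<^sup>\<star>\<parallel> * \<parallel>y\<parallel>"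
      using nrm_mult[OF adj_closed[OF y] y] cstar_identity[OF y] by (simp add: power2_eq_square)
    then show ?thesis using pos by simp
  qed
  assume "x \<in> carrier A"
  then show ?thesis using le[of x] le[of "x\<^sup>\<star>"] adj_closed adj_adj by fastforce
qed

lemma cstar_subalgebra_carrier: "cstar_subalgebra (carrier A) A"
  unfolding cstar_subalgebra_def using smult_closed adj_closed by simp

lemma cstar_subalgebra_generated:
  assumes "X \<subseteq> carrier A"
  shows "cstar_subalgebra (cstar_generated A X) A" "X \<subseteq> cstar_generated A X"
proof -
  have "carrier A \<in> {H. cstar_subalgebra H A \<and> X \<subseteq> H}"
    using assms cstar_subalgebra_carrier by simp
  then have car: "cstar_generated A X \<subseteq> carrier A" unfolding cstar_generated_def by (rule Inter_lower)
  have gen: "y \<in> cstar_generated A X \<longleftrightarrow> (\<forall>H. cstar_subalgebra H A \<and> X \<subseteq> H \<longrightarrow> y \<in> H)" for y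
    unfolding cstar_generated_def by simp
  have lim: "l \<in> cstar_generated A X"
    if l: "l \<in> carrier A" and \<sigma>: "(\<forall>n. \<sigma> n \<in> cstar_generated A X) \<and> cstar_tendsto A \<sigma> l" for \<sigma> l
    unfolding gen
  proof (intro allI impI)
    fix H assume H: "cstar_subalgebra H A \<and> X \<subseteq> H"
    then have "\<forall>n. \<sigma> n \<in> H" using \<sigma> gen by simp
    moreover have "\<forall>\<sigma>. \<forall>l\<in>carrier A. (\<forall>n. \<sigma> n \<in> H) \<and> cstar_tendsto A \<sigma> l \<longrightarrow> l \<in> H"
      using H unfolding cstar_subalgebra_def by (elim conjE)
    note bspec[OF spec[OF this, of \<sigma>] l]
    ultimately show "l \<in> H" using \<sigma> by simp
  qed
  have alg: "\<one> \<in> cstar_generated A X"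
    "\<forall>x\<in>cstar_generated A X. \<forall>y\<in>cstar_generated A X.
      x \<oplus> y \<in> cstar_generated A X \<and> x \<otimes> y \<in> cstar_generated A X"
    "\<forall>a. \<forall>x\<in>cstar_generated A X. a \<odot> x \<in> cstar_generated A X"
    "\<forall>x\<in>cstar_generated A X. x\<^sup>\<star> \<in> cstar_generated A X"
    by (simp_all add: gen cstar_subalgebra_def)
  have "\<forall>\<sigma>. \<forall>l\<in>carrier A. (\<forall>n. \<sigma> n \<in> cstar_generated A X) \<and> cstar_tendsto A \<sigma> l \<longrightarrow>
      l \<in> cstar_generated A X"
    by (intro allI ballI impI) (rule lim)
  with car alg show "cstar_subalgebra (cstar_generated A X) A"
    unfolding cstar_subalgebra_def[of "cstar_generated A X"] by (intro conjI)
  show "X \<subseteq> cstar_generated A X" unfolding cstar_generated_def by blast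
qed

lemma cstar_algebra_restrict:
  assumes H: "cstar_subalgebra H A"
  shows "cstar_algebra (A\<lparr>carrier := H\<rparr>)" (is "cstar_algebra ?B")
proof -
  have sub: "\<And>x. x \<in> H \<Longrightarrow> x \<in> carrier A" and one: "\<one> \<in> H"
    and add: "\<And>x y. \<lbrakk>x \<in> H; y \<in> H\<rbrakk> \<Longrightarrow> x \<oplus> y \<in> H"
    and mult: "\<And>x y. \<lbrakk>x \<in> H; y \<in> H\<rbrakk> \<Longrightarrow> x \<otimes> y \<in> H"
    and sm: "\<And>a x. x \<in> H \<Longrightarrow> a \<odot> x \<in> H" and ad: "\<And>x. x \<in> H \<Longrightarrow> x\<^sup>\<star> \<in> H"
    and cl: "\<And>\<sigma> l. \<lbrakk>l \<in> carrier A; \<And>n. \<sigma> n \<in> H; cstar_tendsto A \<sigma> l\<rbrakk> \<Longrightarrow> l \<in> H"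
    using H unfolding cstar_subalgebra_def by blast+
  have zero: "\<zero> \<in> H" using sm[OF one, of 0] smult_zero_left by simp
  have minv: "\<ominus> x \<in> H" if "x \<in> H" for x using sm[OF that] a_inv_smult sub[OF that] by metis
  interpret B: ring ?B
  proof (intro ringI abelian_groupI monoidI)
    fix x assume "x \<in> carrier ?B"
    then show "\<exists>y\<in>carrier ?B. y \<oplus>\<^bsub>?B\<^esub> x = \<zero>\<^bsub>?B\<^esub>"
      using minv[of x] sub[of x] l_neg[of x] by auto
  qed (use sub one add mult zero in \<open>simp_all add: a_ac m_assoc l_distr r_distr\<close>)
  have inv: "\<ominus>\<^bsub>?B\<^esub> x = \<ominus> x" if "x \<in> H" for x
    using B.minus_equality[of "\<ominus> x" x] minv[OF that] that sub[OF that] l_neg by simp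
  have minus: "x \<ominus>\<^bsub>?B\<^esub> y = x \<ominus> y" if "x \<in> H" "y \<in> H" for x y
    using inv[OF that(2)] by (simp add: a_minus_def)
  show ?thesis
  proof
    fix \<sigma> :: "nat \<Rightarrow> 'a"
    assume "\<And>n. \<sigma> n \<in> carrier ?B" and C: "cstar_Cauchy ?B \<sigma>"
    then have \<sigma>: "\<And>n. \<sigma> n \<in> H" by simp
    have "cstar_Cauchy A \<sigma>" using C unfolding cstar_Cauchy_def by (simp add: minus \<sigma>)
    then obtain l where l: "l \<in> carrier A" "cstar_tendsto A \<sigma> l" using complete \<sigma> sub by metis
    then have "l \<in> H" using cl \<sigma> by blast
    then show "\<exists>l\<in>carrier ?B. cstar_tendsto ?B \<sigma> l"
      using l(2) \<sigma> unfolding cstar_tendsto_def by (auto simp: minus)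
  next
    fix x assume "x \<in> carrier ?B"
    then have "x \<in> carrier A" using sub by simp
    then show "(\<parallel>x\<parallel>\<^bsub>?B\<^esub> = 0) = (x = \<zero>\<^bsub>?B\<^esub>)" "\<parallel>x\<^sup>\<star>\<^bsub>?B\<^esub> \<otimes>\<^bsub>?B\<^esub> x\<parallel>\<^bsub>?B\<^esub> = \<parallel>x\<parallel>\<^bsub>?B\<^esub>\<^sup>2"
      using nrm_eq_0 cstar_identity by simp_all
  qed (use sub sm ad in \<open>simp_all add: smult_l_distr smult_r_distr smult_assoc smult_one
        smult_mult_l smult_mult_r adj_adj adj_add adj_smult adj_mult nrm_nonneg nrm_triangle
        nrm_smult nrm_mult\<close>)
qed

end

text \<open>*-polynomials in the elements of \<open>X\<close> with coefficients from \<open>K\<close>; for countable dense \<open>K\<close> and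
  countable \<open>X\<close> they form a countable dense subset of the generated C*-algebra.\<close>

inductive_set star_polys :: "('a, 'm) cstar_scheme \<Rightarrow> complex set \<Rightarrow> 'a set \<Rightarrow> 'a set"
  for A :: "('a, 'm) cstar_scheme" and K :: "complex set" and X :: "'a set" where
  base: "x \<in> X \<Longrightarrow> x \<in> star_polys A K X"
| one: "\<one>\<^bsub>A\<^esub> \<in> star_polys A K X"
| add: "\<lbrakk>x \<in> star_polys A K X; y \<in> star_polys A K X\<rbrakk> \<Longrightarrow> x \<oplus>\<^bsub>A\<^esub> y \<in> star_polys A K X"
| mult: "\<lbrakk>x \<in> star_polys A K X; y \<in> star_polys A K X\<rbrakk> \<Longrightarrow> x \<otimes>\<^bsub>A\<^esub> y \<in> star_polys A K X"
| smult: "\<lbrakk>a \<in> K; x \<in> star_polys A K X\<rbrakk> \<Longrightarrow> a \<odot>\<^bsub>A\<^esub> x \<in> star_polys A K X"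
| adj: "x \<in> star_polys A K X \<Longrightarrow> x\<^sup>\<star>\<^bsub>A\<^esub> \<in> star_polys A K X"

datatype ('k, 'x) star_term = Base 'x | One | Add "('k, 'x) star_term" "('k, 'x) star_term"
  | Mult "('k, 'x) star_term" "('k, 'x) star_term" | Smult 'k "('k, 'x) star_term"
  | Adj "('k, 'x) star_term"

instance star_term :: (countable, countable) countable by countable_datatype

primrec eval_star_term ::
  "('a, 'm) cstar_scheme \<Rightarrow> (nat \<Rightarrow> complex) \<Rightarrow> (nat \<Rightarrow> 'a) \<Rightarrow> (nat, nat) star_term \<Rightarrow> 'a"
where
  "eval_star_term A k v (Base i) = v i"
| "eval_star_term A k v One = \<one>\<^bsub>A\<^esub>"
| "eval_star_term A k v (Add s t) = eval_star_term A k v s \<oplus>\<^bsub>A\<^esub> eval_star_term A k v t"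
| "eval_star_term A k v (Mult s t) = eval_star_term A k v s \<otimes>\<^bsub>A\<^esub> eval_star_term A k v t"
| "eval_star_term A k v (Smult i t) = k i \<odot>\<^bsub>A\<^esub> eval_star_term A k v t"
| "eval_star_term A k v (Adj t) = (eval_star_term A k v t)\<^sup>\<star>\<^bsub>A\<^esub>"

lemma countable_star_polys:
  assumes "countable K" "countable X"
  shows "countable (star_polys A K X)"
proof -
  have "star_polys A K X \<subseteq> range (eval_star_term A (from_nat_into K) (from_nat_into X))"
  proof
    let ?e = "eval_star_term A (from_nat_into K) (from_nat_into X)"
    fix x assume "x \<in> star_polys A K X"
    then show "x \<in> range (eval_star_term A (from_nat_into K) (from_nat_into X))"
    proof induction
      case (base x)
      then obtain i where "from_nat_into X i = x" using assms(2) from_nat_into_surj by metis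
      then show ?case by (metis eval_star_term.simps(1) rangeI)
    next
      case one then show ?case by (metis eval_star_term.simps(2) rangeI)
    next
      case (add x y)
      then obtain s t where "x = ?e s" "y = ?e t" by blast
      then show ?case using rangeI[of ?e "Add s t"] by simp
    next
      case (mult x y)
      then obtain s t where "x = ?e s" "y = ?e t" by blast
      then show ?case using rangeI[of ?e "Mult s t"] by simp
    next
      case (smult a x)
      then obtain i where "from_nat_into K i = a" using assms(1) from_nat_into_surj by metis
      moreover obtain t where "x = ?e t" using smult by blast
      ultimately show ?case using rangeI[of ?e "Smult i t"] by simp
    next
      case (adj x)
      then obtain t where "x = ?e t" by blast
      then show ?case using rangeI[of ?e "Adj t"] by simp
    qed
  qed
  then show ?thesis by (rule countable_subset) simp
qed

context cstar_algebra
begin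

definition nrm_closure :: "'a set \<Rightarrow> 'a set" where
  "nrm_closure D = {x \<in> carrier A. \<forall>e>0. \<exists>d\<in>D. \<parallel>x \<ominus> d\<parallel> < e}"

lemma nrm_minus_self: "x \<in> carrier A \<Longrightarrow> \<parallel>x \<ominus> x\<parallel> = 0"
  using nrm_eq_0[of \<zero>] by (simp add: r_neg a_minus_def)

lemma nrm_minus_add:
  assumes "x \<in> carrier A" "y \<in> carrier A" "d \<in> carrier A" "e \<in> carrier A"
  shows "\<parallel>(x \<oplus> y) \<ominus> (d \<oplus> e)\<parallel> \<le> \<parallel>x \<ominus> d\<parallel> + \<parallel>y \<ominus> e\<parallel>"
proof -
  have "(x \<oplus> y) \<ominus> (d \<oplus> e) = (x \<ominus> d) \<oplus> (y \<ominus> e)"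
    using assms by (simp add: a_minus_def minus_add a_ac)
  then show ?thesis using nrm_triangle[of "x \<ominus> d" "y \<ominus> e"] assms by simp
qed

lemma nrm_minus_mult:
  assumes "x \<in> carrier A" "y \<in> carrier A" "d \<in> carrier A" "e \<in> carrier A"
  shows "\<parallel>(x \<otimes> y) \<ominus> (d \<otimes> e)\<parallel> \<le> \<parallel>x \<ominus> d\<parallel> * \<parallel>y\<parallel> + \<parallel>d\<parallel> * \<parallel>y \<ominus> e\<parallel>"
proof -
  have "(x \<ominus> d) \<otimes> y = (x \<otimes> y) \<ominus> (d \<otimes> y)" "d \<otimes> (y \<ominus> e) = (d \<otimes> y) \<ominus> (d \<otimes> e)"
    using assms by (simp_all add: a_minus_def l_distr r_distr l_minus r_minus)
  then show ?thesis
    using nrm_minus_triangle[of "x \<otimes> y" "d \<otimes> y" "d \<otimes> e"] assms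
      nrm_mult[of "x \<ominus> d" y] nrm_mult[of d "y \<ominus> e"] by simp
qed

lemma nrm_minus_adj:
  assumes "x \<in> carrier A" "d \<in> carrier A"
  shows "\<parallel>x\<^sup>\<star> \<ominus> d\<^sup>\<star>\<parallel> = \<parallel>x \<ominus> d\<parallel>"
proof -
  have "(\<ominus> d)\<^sup>\<star> = \<ominus> (d\<^sup>\<star>)"
    using assms(2) adj_smult[of d "-1"] a_inv_smult adj_closed by simp
  then have "(x \<ominus> d)\<^sup>\<star> = x\<^sup>\<star> \<ominus> d\<^sup>\<star>"
    using assms by (simp add: a_minus_def adj_add)
  then show ?thesis using nrm_adj[of "x \<ominus> d"] assms by simp
qed

lemma nrm_minus_smult:
  assumes "x \<in> carrier A" "d \<in> carrier A"
  shows "\<parallel>(a \<odot> x) \<ominus> (b \<odot> d)\<parallel> \<le> cmod (a - b) * \<parallel>x\<parallel> + cmod b * \<parallel>x \<ominus> d\<parallel>"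
proof -
  have inv: "\<ominus> (c \<odot> y) = (- c) \<odot> y" if "y \<in> carrier A" for c y
    using a_inv_smult[of "c \<odot> y"] smult_assoc[OF that, of "-1" c] smult_closed[OF that] by simp
  have "(a \<odot> x) \<ominus> (b \<odot> x) = (a - b) \<odot> x"
    using assms inv[of x b] smult_l_distr[of x a "- b"] by (simp add: a_minus_def)
  moreover have "b \<odot> (x \<ominus> d) = (b \<odot> x) \<ominus> (b \<odot> d)"
    using assms inv[of d b] a_inv_smult[of d] smult_closed smult_r_distr[of x "\<ominus> d" b]
      smult_assoc[of d b "-1"] by (simp add: a_minus_def)
  ultimately show ?thesis
    using nrm_minus_triangle[of "a \<odot> x" "b \<odot> x" "b \<odot> d"] assms smult_closed
      nrm_smult[of x "a - b"] nrm_smult[of "x \<ominus> d" b] by simp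
qed

lemma nrm_le_near:
  assumes "x \<in> carrier A" "d \<in> carrier A" "\<parallel>x \<ominus> d\<parallel> < 1"
  shows "\<parallel>d\<parallel> < \<parallel>x\<parallel> + 1"
  using nrm_minus_triangle[of d x \<zero>] nrm_minus_commute[of d x] assms
  by (simp add: a_minus_def)

lemma star_polys_closed:
  assumes "X \<subseteq> carrier A" "x \<in> star_polys A K X"
  shows "x \<in> carrier A"
  using assms(2) by induction (use assms(1) smult_closed adj_closed in auto)

lemma dense_star_polys:
  assumes X: "X \<subseteq> carrier A" and K: "\<And>(a::complex) e. e > 0 \<Longrightarrow> \<exists>b\<in>K. cmod (a - b) < e"
  shows "cstar_subalgebra (nrm_closure (star_polys A K X)) A"
proof -
  let ?D = "star_polys A K X"
  have D: "\<And>d. d \<in> ?D \<Longrightarrow> d \<in> carrier A" using star_polys_closed[OF X] .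
  have incl: "x \<in> nrm_closure ?D" if "x \<in> ?D" for x
    using that D nrm_minus_self unfolding nrm_closure_def by force
  have approx: "\<exists>d\<in>?D. d \<in> carrier A \<and> \<parallel>x \<ominus> d\<parallel> < e" if "x \<in> nrm_closure ?D" "e > 0" for x e
    using that D unfolding nrm_closure_def by blast
  have car: "x \<in> carrier A" if "x \<in> nrm_closure ?D" for x
    using that unfolding nrm_closure_def by blast
  have I: "x \<in> nrm_closure ?D"
    if "x \<in> carrier A" "\<And>e. e > 0 \<Longrightarrow> \<exists>d\<in>?D. \<parallel>x \<ominus> d\<parallel> < e" for x
    using that unfolding nrm_closure_def by blast
  have add: "x \<oplus> y \<in> nrm_closure ?D" if xy: "x \<in> nrm_closure ?D" "y \<in> nrm_closure ?D" for x y
  proof (rule I)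
    show "x \<oplus> y \<in> carrier A" using car xy by simp
    fix e :: real assume "e > 0"
    then obtain d d' where d: "d \<in> ?D" "d' \<in> ?D" "\<parallel>x \<ominus> d\<parallel> < e/2" "\<parallel>y \<ominus> d'\<parallel> < e/2"
      using approx[of x "e/2"] approx[of y "e/2"] xy by (meson half_gt_zero)
    show "\<exists>d\<in>?D. \<parallel>(x \<oplus> y) \<ominus> d\<parallel> < e"
    proof (rule bexI)
      show "\<parallel>(x \<oplus> y) \<ominus> (d \<oplus> d')\<parallel> < e"
        using nrm_minus_add[OF car[OF xy(1)] car[OF xy(2)] D[OF d(1)] D[OF d(2)]] d by linarith
    qed (rule star_polys.add[OF d(1,2)])
  qed
  have mult: "x \<otimes> y \<in> nrm_closure ?D" if xy: "x \<in> nrm_closure ?D" "y \<in> nrm_closure ?D" for x y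
  proof (rule I)
    show "x \<otimes> y \<in> carrier A" using car xy by simp
    fix e :: real assume e: "e > 0"
    define M where "M = \<parallel>x\<parallel> + \<parallel>y\<parallel> + 1"
    have M: "M > 0" "\<parallel>y\<parallel> \<le> M" using nrm_nonneg car xy by (simp_all add: M_def add_nonneg_pos)
    define \<delta> where "\<delta> = min 1 (e / (2 * M))"
    have \<delta>: "\<delta> > 0" "\<delta> \<le> 1" "\<delta> \<le> e / (2 * M)" using e M by (simp_all add: \<delta>_def)
    obtain d d' where d: "d \<in> ?D" "d' \<in> ?D" "\<parallel>x \<ominus> d\<parallel> < \<delta>" "\<parallel>y \<ominus> d'\<parallel> < \<delta>"
      using approx[OF xy(1) \<delta>(1)] approx[OF xy(2) \<delta>(1)] by blast
    have dc: "d \<in> carrier A" "d' \<in> carrier A" using D d by blast+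
    have dM: "\<parallel>d\<parallel> \<le> M"
      using nrm_le_near[of x d] car xy dc d \<delta> nrm_nonneg[of y] by (simp add: M_def)
    have "\<parallel>x \<ominus> d\<parallel> * \<parallel>y\<parallel> \<le> \<parallel>x \<ominus> d\<parallel> * M"
      using M nrm_nonneg car xy dc by (intro mult_left_mono) auto
    also have "\<dots> < \<delta> * M" using d M by simp
    also have "\<dots> \<le> e / (2 * M) * M" using \<delta> M by (intro mult_right_mono) auto
    also have "\<dots> = e / 2" using M by simp
    finally have 1: "\<parallel>x \<ominus> d\<parallel> * \<parallel>y\<parallel> < e / 2" .
    have "\<parallel>d\<parallel> * \<parallel>y \<ominus> d'\<parallel> \<le> M * \<parallel>y \<ominus> d'\<parallel>"
      using dM nrm_nonneg car xy dc by (intro mult_right_mono) auto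
    also have "\<dots> \<le> M * \<delta>" using d M by (intro mult_left_mono) auto
    also have "\<dots> \<le> M * (e / (2 * M))" using \<delta> M by (intro mult_left_mono) auto
    also have "\<dots> = e / 2" using M by simp
    finally have 2: "\<parallel>d\<parallel> * \<parallel>y \<ominus> d'\<parallel> \<le> e / 2" .
    show "\<exists>d\<in>?D. \<parallel>(x \<otimes> y) \<ominus> d\<parallel> < e"
    proof (rule bexI)
      show "\<parallel>(x \<otimes> y) \<ominus> (d \<otimes> d')\<parallel> < e"
        using nrm_minus_mult[OF car[OF xy(1)] car[OF xy(2)] dc] 1 2 by linarith
    qed (rule star_polys.mult[OF d(1,2)])
  qed
  have sm: "a \<odot> x \<in> nrm_closure ?D" if x: "x \<in> nrm_closure ?D" for a x
  proof (rule I)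
    show "a \<odot> x \<in> carrier A" using car x smult_closed by simp
    fix e :: real assume e: "e > 0"
    define M where "M = \<parallel>x\<parallel> + cmod a + 1"
    have M: "M > 0" "\<parallel>x\<parallel> \<le> M" using nrm_nonneg car x by (simp_all add: M_def add_nonneg_pos)
    define \<delta> where "\<delta> = min 1 (e / (2 * M))"
    have \<delta>: "\<delta> > 0" "\<delta> \<le> 1" "\<delta> \<le> e / (2 * M)" using e M by (simp_all add: \<delta>_def)
    obtain b d where d: "b \<in> K" "d \<in> ?D" "cmod (a - b) < \<delta>" "\<parallel>x \<ominus> d\<parallel> < \<delta>"
      using approx[OF x \<delta>(1)] K[OF \<delta>(1), of a] by blast
    have dc: "d \<in> carrier A" using D d by blast
    have bM: "cmod b \<le> M"
      using norm_triangle_ineq2[of b a] d \<delta> nrm_nonneg[of x] car x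
      by (simp add: M_def norm_minus_commute)
    have "cmod (a - b) * \<parallel>x\<parallel> \<le> cmod (a - b) * M"
      using M by (intro mult_left_mono) auto
    also have "\<dots> < \<delta> * M" using d M by simp
    also have "\<dots> \<le> e / (2 * M) * M" using \<delta> M by (intro mult_right_mono) auto
    also have "\<dots> = e / 2" using M by simp
    finally have 1: "cmod (a - b) * \<parallel>x\<parallel> < e / 2" .
    have "cmod b * \<parallel>x \<ominus> d\<parallel> \<le> M * \<parallel>x \<ominus> d\<parallel>"
      using bM nrm_nonneg car x dc by (intro mult_right_mono) auto
    also have "\<dots> \<le> M * \<delta>" using d M by (intro mult_left_mono) auto
    also have "\<dots> \<le> M * (e / (2 * M))" using \<delta> M by (intro mult_left_mono) auto
    also have "\<dots> = e / 2" using M by simp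
    finally have 2: "cmod b * \<parallel>x \<ominus> d\<parallel> \<le> e / 2" .
    show "\<exists>d\<in>?D. \<parallel>(a \<odot> x) \<ominus> d\<parallel> < e"
    proof (rule bexI)
      show "\<parallel>(a \<odot> x) \<ominus> (b \<odot> d)\<parallel> < e"
        using nrm_minus_smult[OF car[OF x] dc, of a b] 1 2 by linarith
    qed (rule star_polys.smult[OF d(1,2)])
  qed
  have ad: "x\<^sup>\<star> \<in> nrm_closure ?D" if x: "x \<in> nrm_closure ?D" for x
  proof (rule I)
    show "x\<^sup>\<star> \<in> carrier A" using car x adj_closed by simp
    fix e :: real assume "e > 0"
    then obtain d where "d \<in> ?D" "\<parallel>x \<ominus> d\<parallel> < e" using approx x by blast
    then show "\<exists>d\<in>?D. \<parallel>x\<^sup>\<star> \<ominus> d\<parallel> < e"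
      using nrm_minus_adj[OF car[OF x] D] star_polys.adj by metis
  qed
  have cl: "l \<in> nrm_closure ?D"
    if \<sigma>: "\<And>n. \<sigma> n \<in> nrm_closure ?D" and l: "l \<in> carrier A" and lim: "cstar_tendsto A \<sigma> l" for \<sigma> l
  proof (rule I[OF l])
    fix e :: real assume e: "e > 0"
    then have "\<forall>\<^sub>F n in sequentially. \<parallel>\<sigma> n \<ominus> l\<parallel> < e / 2"
      using lim unfolding cstar_tendsto_def by (metis half_gt_zero order_tendstoD(2))
    then obtain n where n: "\<parallel>\<sigma> n \<ominus> l\<parallel> < e / 2" unfolding eventually_sequentially by blast
    obtain d where d: "d \<in> ?D" "d \<in> carrier A" "\<parallel>\<sigma> n \<ominus> d\<parallel> < e / 2"
      using approx[OF \<sigma>, of "e/2" n] e half_gt_zero by blast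
    show "\<exists>d\<in>?D. \<parallel>l \<ominus> d\<parallel> < e"
    proof (rule bexI)
      show "\<parallel>l \<ominus> d\<parallel> < e"
        using nrm_minus_triangle[OF l car[OF \<sigma>[of n]] d(2)]
          nrm_minus_commute[OF l car[OF \<sigma>[of n]]] n d(3) by linarith
    qed (rule d(1))
  qed
  show ?thesis
    unfolding cstar_subalgebra_def
  proof (intro conjI ballI allI impI subsetI)
    show "l \<in> nrm_closure ?D"
      if "l \<in> carrier A" "(\<forall>n. \<sigma> n \<in> nrm_closure ?D) \<and> cstar_tendsto A \<sigma> l" for \<sigma> l
      using cl[of \<sigma> l] that by simp
  qed (fact car incl[OF star_polys.one] add mult sm ad)+
qed

lemma generated_inj:
  assumes X: "X \<subseteq> carrier A" "countable X"
  shows "\<exists>j :: 'a \<Rightarrow> nat \<Rightarrow> complex. inj_on j (cstar_generated A X)"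
proof -
  obtain K :: "complex set" where K: "countable K"
      "\<And>T. open T \<Longrightarrow> T \<noteq> {} \<Longrightarrow> \<exists>b\<in>K. b \<in> T"
    by (rule countable_dense_setE) blast
  have K': "\<exists>b\<in>K. cmod (a - b) < e" if "e > 0" for a :: complex and e
    using K(2)[of "ball a e"] that by (auto simp: dist_norm)
  let ?D = "star_polys A K X"
  have cD: "countable ?D" using countable_star_polys K(1) X(2) by blast
  have D: "\<And>d. d \<in> ?D \<Longrightarrow> d \<in> carrier A" using star_polys_closed[OF X(1)] .
  have "X \<subseteq> nrm_closure ?D"
    unfolding nrm_closure_def
  proof (intro subsetI CollectI conjI allI impI)
    fix x and e :: real assume x: "x \<in> X" and "e > 0"
    then show "\<exists>d\<in>?D. \<parallel>x \<ominus> d\<parallel> < e"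
      using X(1) nrm_minus_self[of x] star_polys.base[OF x, of A K] by (intro bexI[of _ x]) auto
  qed (use X(1) in blast)
  moreover have "cstar_subalgebra (nrm_closure ?D) A" by (rule dense_star_polys[OF X(1) K'])
  ultimately have sub: "cstar_generated A X \<subseteq> nrm_closure ?D"
    unfolding cstar_generated_def by (intro Inter_lower) simp
  define p where "p x n = (SOME d. d \<in> ?D \<and> \<parallel>x \<ominus> d\<parallel> < 1 / real (Suc n))" for x n
  have p: "p x n \<in> ?D \<and> \<parallel>x \<ominus> p x n\<parallel> < 1 / real (Suc n)" if "x \<in> nrm_closure ?D" for x n
    unfolding p_def
  proof (rule someI_ex)
    have "0 < 1 / real (Suc n)" by simp
    then show "\<exists>d. d \<in> ?D \<and> \<parallel>x \<ominus> d\<parallel> < 1 / real (Suc n)"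
      using that unfolding nrm_closure_def by blast
  qed
  define j :: "'a \<Rightarrow> nat \<Rightarrow> complex" where "j x n = of_nat (to_nat_on ?D (p x n))" for x n
  have "inj_on j (nrm_closure ?D)"
  proof (rule inj_onI)
    fix x y assume x: "x \<in> nrm_closure ?D" and y: "y \<in> nrm_closure ?D" and eq: "j x = j y"
    have xy: "x \<in> carrier A" "y \<in> carrier A" using x y unfolding nrm_closure_def by auto
    have le: "\<parallel>x \<ominus> y\<parallel> \<le> 2 / real (Suc n)" for n
    proof -
      have "to_nat_on ?D (p x n) = to_nat_on ?D (p y n)"
        using fun_cong[OF eq, of n] unfolding j_def by simp
      then have same: "p x n = p y n"
        using to_nat_on_inj[OF cD] p[OF x] p[OF y] by blast
      then show ?thesis
        using nrm_minus_triangle[of x "p x n" y] nrm_minus_commute[of y "p y n"]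
          p[OF x, of n] p[OF y, of n] xy D[of "p x n"] by simp
    qed
    have "\<parallel>x \<ominus> y\<parallel> \<le> 0"
    proof (rule ccontr)
      assume "\<not> \<parallel>x \<ominus> y\<parallel> \<le> 0"
      then obtain n where "inverse (real (Suc n)) < \<parallel>x \<ominus> y\<parallel> / 2"
        using reals_Archimedean[of "\<parallel>x \<ominus> y\<parallel> / 2"] by auto
      then show False using le[of n] by (simp add: field_simps)
    qed
    then have "x \<ominus> y = \<zero>"
      using nrm_nonneg[of "x \<ominus> y"] nrm_eq_0[of "x \<ominus> y"] xy by simp
    moreover have "x = (x \<ominus> y) \<oplus> y" using xy by (simp add: a_minus_def a_assoc l_neg)
    ultimately show "x = y" using xy by simp
  qed
  then show ?thesis using sub inj_on_subset by blast
qed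

end

definition transport :: "('a \<Rightarrow> 'b) \<Rightarrow> ('a, 'm) cstar_scheme \<Rightarrow> 'b cstar" where
  "transport j A = (let g = inv_into (carrier A) j in
     \<lparr>carrier = j ` carrier A, mult = \<lambda>x y. j (g x \<otimes>\<^bsub>A\<^esub> g y), one = j \<one>\<^bsub>A\<^esub>,
      zero = j \<zero>\<^bsub>A\<^esub>, add = \<lambda>x y. j (g x \<oplus>\<^bsub>A\<^esub> g y), smult = \<lambda>a x. j (a \<odot>\<^bsub>A\<^esub> g x),
      adj = \<lambda>x. j ((g x)\<^sup>\<star>\<^bsub>A\<^esub>), nrm = \<lambda>x. \<parallel>g x\<parallel>\<^bsub>A\<^esub>\<rparr>)"

lemma (in cstar_algebra) cstar_algebra_transport:
  fixes j :: "'a \<Rightarrow> 'c"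
  assumes j: "inj_on j (carrier A)"
  shows "cstar_algebra (transport j A)"
    and "inv_into (carrier A) j \<in> star_hom (transport j A) A"
proof -
  let ?T = "transport j A" and ?g = "inv_into (carrier A) j"
  have T: "carrier ?T = j ` carrier A" "\<one>\<^bsub>?T\<^esub> = j \<one>" "\<zero>\<^bsub>?T\<^esub> = j \<zero>"
    "x \<otimes>\<^bsub>?T\<^esub> y = j (?g x \<otimes> ?g y)" "x \<oplus>\<^bsub>?T\<^esub> y = j (?g x \<oplus> ?g y)" "a \<odot>\<^bsub>?T\<^esub> x = j (a \<odot> ?g x)"
    "x\<^sup>\<star>\<^bsub>?T\<^esub> = j ((?g x)\<^sup>\<star>)" "\<parallel>x\<parallel>\<^bsub>?T\<^esub> = \<parallel>?g x\<parallel>" for x y a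
    by (simp_all add: transport_def Let_def)
  have g: "?g (j x) = x" if "x \<in> carrier A" for x using j that by simp
  have jeq: "j x = j y \<longleftrightarrow> x = y" if "x \<in> carrier A" "y \<in> carrier A" for x y
    using j that by (simp add: inj_on_eq_iff)
  interpret T: ring ?T
  proof (intro ringI abelian_groupI monoidI)
    fix x assume "x \<in> carrier ?T"
    then obtain z where z: "z \<in> carrier A" "x = j z" by (auto simp: T)
    then have "j (\<ominus> z) \<in> carrier ?T" "j (\<ominus> z) \<oplus>\<^bsub>?T\<^esub> x = \<zero>\<^bsub>?T\<^esub>" by (simp_all add: T g l_neg)
    then show "\<exists>y\<in>carrier ?T. y \<oplus>\<^bsub>?T\<^esub> x = \<zero>\<^bsub>?T\<^esub>" by blast
  qed (auto simp: T g a_ac m_assoc l_distr r_distr)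
  have inv: "\<ominus>\<^bsub>?T\<^esub> (j x) = j (\<ominus> x)" if "x \<in> carrier A" for x
    using T.minus_equality[of "j (\<ominus> x)" "j x"] that by (simp add: T g l_neg)
  have minus: "x \<ominus>\<^bsub>?T\<^esub> y = j (?g x \<ominus> ?g y)" if "x \<in> carrier ?T" "y \<in> carrier ?T" for x y
  proof -
    obtain u v where uv: "u \<in> carrier A" "v \<in> carrier A" "x = j u" "y = j v"
      using \<open>x \<in> carrier ?T\<close> \<open>y \<in> carrier ?T\<close> by (auto simp: T(1))
    have "x \<ominus>\<^bsub>?T\<^esub> y = j u \<oplus>\<^bsub>?T\<^esub> j (\<ominus> v)"
      using uv inv by (simp add: a_minus_def)
    then show ?thesis using uv by (simp add: T(5) g a_minus_def)
  qed
  have gT: "?g x \<in> carrier A" if "x \<in> carrier ?T" for x using that g by (auto simp: T)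
  show "cstar_algebra ?T"
  proof
    fix \<sigma> :: "nat \<Rightarrow> 'c"
    assume \<sigma>: "\<And>n. \<sigma> n \<in> carrier ?T" and C: "cstar_Cauchy ?T \<sigma>"
    have "cstar_Cauchy A (\<lambda>n. ?g (\<sigma> n))"
      using C \<sigma> gT unfolding cstar_Cauchy_def by (simp add: minus T g)
    then obtain l where l: "l \<in> carrier A" "cstar_tendsto A (\<lambda>n. ?g (\<sigma> n)) l"
      using complete[of "\<lambda>n. ?g (\<sigma> n)"] gT \<sigma> by blast
    have "j l \<in> carrier ?T" using l by (simp add: T)
    moreover from this have "cstar_tendsto ?T \<sigma> (j l)"
      using l \<sigma> gT unfolding cstar_tendsto_def by (simp add: minus T(8) g)
    ultimately show "\<exists>l\<in>carrier ?T. cstar_tendsto ?T \<sigma> l" by blast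
  qed (auto simp: T g jeq smult_closed adj_closed smult_l_distr smult_r_distr smult_assoc smult_one
        smult_mult_l smult_mult_r adj_adj adj_add adj_smult adj_mult nrm_nonneg nrm_triangle
        nrm_smult nrm_mult nrm_eq_0 cstar_identity)
  show "?g \<in> star_hom ?T A"
    unfolding star_hom_def ring_hom_def by (auto simp: T g smult_closed adj_closed)
qed

theorem two_adic_ring_universal:
  fixes Q :: "('a, 'm) cstar_scheme" and B :: "('b, 'n) cstar_scheme"
  assumes Q: "two_adic_ring_cstar Q U S" and B: "cstar_algebra B" and us: "two_adic_relations B u s"
  shows "\<exists>\<phi>\<in>star_hom Q B. \<phi> U = u \<and> \<phi> S = s"
proof -
  interpret B: cstar_algebra B by fact
  have X: "{u, s} \<subseteq> carrier B" using us unfolding two_adic_relations_def by blast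
  define H where "H = cstar_generated B {u, s}"
  have H: "cstar_subalgebra H B" "u \<in> H" "s \<in> H"
    using B.cstar_subalgebra_generated[OF X] unfolding H_def by auto
  define C where "C = B\<lparr>carrier := H\<rparr>"
  interpret C: cstar_algebra C unfolding C_def using B.cstar_algebra_restrict[OF H(1)] .
  have uC: "u \<in> carrier C" "s \<in> carrier C" using H by (simp_all add: C_def)
  have relC: "two_adic_relations C u s"
    using us H(2,3) unfolding two_adic_relations_def C_def by (simp add: nat_pow_def)
  obtain j :: "'b \<Rightarrow> nat \<Rightarrow> complex" where j: "inj_on j (carrier C)"
    using B.generated_inj[OF X] unfolding C_def H_def by auto
  let ?T = "transport j C" and ?g = "inv_into (carrier C) j"
  have g: "?g (j x) = x" if "x \<in> carrier C" for x using j that by simp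
  have relT: "two_adic_relations ?T (j u) (j s)"
    using relC uC C.adj_closed unfolding two_adic_relations_def
    by (simp add: transport_def Let_def g numeral_2_eq_2 nat_pow_def)
  obtain \<phi> where \<phi>: "\<phi> \<in> star_hom Q ?T" "\<phi> U = j u" "\<phi> S = j s"
    using Q C.cstar_algebra_transport(1)[OF j] relT unfolding two_adic_ring_cstar_def by blast
  have gT: "?g \<in> star_hom ?T C" using C.cstar_algebra_transport(2)[OF j] .
  interpret Qa: cstar_algebra Q using Q unfolding two_adic_ring_cstar_def by blast
  have "?g \<circ> \<phi> \<in> star_hom Q C"
    using \<phi>(1) gT Qa.smult_closed Qa.adj_closed unfolding star_hom_def ring_hom_def Pi_def by simp
  then have "?g \<circ> \<phi> \<in> star_hom Q B"
    using H(1) unfolding star_hom_def ring_hom_def C_def cstar_subalgebra_def Pi_def by auto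
  moreover have "(?g \<circ> \<phi>) U = u" "(?g \<circ> \<phi>) S = s" using \<phi> g uC by simp_all
  ultimately show ?thesis by blast
qed

end

theory Submission
  imports Defs
begin

text \<open>
  Let \<open>\<Lambda>\<close> extend \<open>\<alpha>\<close> and put \<open>W = \<Lambda>(U)\<close>, \<open>R = \<alpha>(S\<^sub>1) = a S\<^sub>1 + c S\<^sub>2\<close> and \<open>L = \<alpha>(S\<^sub>2) = b S\<^sub>1 + d S\<^sub>2\<close>.  Since
  \<open>S\<^sub>2 U = U S\<^sub>1\<close>, the unitary \<open>W\<close> satisfies \<open>L W = W R\<close>, so it is a fixed point of the contraction
  \<open>\<Phi>(x) = L\<^sup>\<star> x R\<close>.  The idea is that \<open>\<Phi>\<close> has almost no room for fixed points.  On powers of \<open>U\<close> it is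
  explicit: \<open>\<Phi>(U\<^sup>2\<^sup>k) = 0\<close> and \<open>\<Phi>(U\<^sup>2\<^sup>k\<^sup>+\<^sup>1) = p U\<^sup>k + q U\<^sup>k\<^sup>+\<^sup>1\<close> with \<open>p = cnj b * c\<close> and \<open>q = cnj d * a\<close>.
  Iteration halves the exponents, so asymptotically only \<open>U\<close> and \<open>U\<^sup>\<star>\<close> matter, with eigenvalues \<open>q\<close>
  and \<open>p\<close>.  A general word in the generators reduces to a power of \<open>U\<close> after multiplication by enough
  factors \<open>L\<^sup>\<star>\<close> on the left and \<open>R\<close> on the right, and such words span a dense subspace.  Hence if each of
  \<open>p\<close>, \<open>q\<close> either has modulus less than 1 or equals \<open>r\<close>, iterated compression drives the whole algebra
  towards the \<open>r\<close>-eigenspace of \<open>\<Phi>\<close>, and \<open>W\<close> can survive only if \<open>r = 1\<close>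
  (\<open>compression_fixed_point_eq_zero\<close>).  The matrix is unitary, so \<open>\<bar>p\<bar> + \<bar>q\<bar> = 1\<close>; trying \<open>r = q\<close> and \<open>r = p\<close>
  leaves only \<open>(p, q) = (0, 1)\<close>, where \<open>\<alpha>\<close> is a gauge automorphism, and \<open>(p, q) = (1, 0)\<close>, where it is the
  flip-flop times a gauge automorphism, unless \<open>W = 0\<close> and the algebra is zero.

  Conversely, \<open>(U, z S\<^sub>2)\<close> and \<open>(U\<^sup>\<star>, z S\<^sub>1)\<close> satisfy the defining relations, and the universal property
  yields endomorphisms with the required values on \<open>S\<^sub>1\<close> and \<open>S\<^sub>2\<close>.  That they agree with \<open>\<alpha>\<close> on all of \<open>\<O>\<^sub>2\<close>
  needs the continuity of *-homomorphisms (\<open>star_hom_contractive\<close>), proved here by writing a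
  self-adjoint element of norm less than 1 as the real part of an isometry.
\<close>

section \<open>Limits in a C*-algebra\<close>

context cstar_algebra
begin

declare smult_closed [simp] adj_closed [simp] adj_adj [simp]

lemma adj_one [simp]: "\<one>\<^sup>\<star> = \<one>"
proof -
  have "\<one>\<^sup>\<star> = \<one>\<^sup>\<star> \<otimes> \<one>" by simp
  also have "\<dots> = (\<one>\<^sup>\<star> \<otimes> \<one>)\<^sup>\<star>" by (subst adj_mult) simp_all
  finally show ?thesis by simp
qed

lemma nrm_one_le: "\<parallel>\<one>\<parallel> \<le> 1"
proof -
  have "\<parallel>\<one>\<parallel>\<^sup>2 = \<parallel>\<one>\<parallel>" using cstar_identity[of \<one>] by simp
  then have "\<parallel>\<one>\<parallel> = 0 \<or> \<parallel>\<one>\<parallel> = 1" by (simp add: power2_eq_square)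
  then show ?thesis by linarith
qed

lemma smult_zero_right [simp]: "a \<odot> \<zero> = \<zero>"
  using smult_assoc[of \<zero> a 0] smult_zero_left[of \<zero>] by simp

lemma nrm_zero [simp]: "\<parallel>\<zero>\<parallel> = 0"
  using nrm_eq_0 by simp

lemma adj_zero [simp]: "\<zero>\<^sup>\<star> = \<zero>"
  using nrm_adj[of \<zero>] nrm_eq_0[of "\<zero>\<^sup>\<star>"] by simp

lemma nrm_isometry_le:
  assumes "x \<in> carrier A" "x\<^sup>\<star> \<otimes> x = \<one>"
  shows "\<parallel>x\<parallel> \<le> 1"
  using cstar_identity[OF assms(1)] nrm_one_le assms by (simp add: abs_square_le_1 power_le_one_iff)

lemma minus_eq_zeroD:
  assumes "x \<in> carrier A" "y \<in> carrier A" "x \<ominus> y = \<zero>"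
  shows "x = y"
  using assms by (metis a_minus_def a_inv_closed minus_equality minus_minus)

lemma nrm_minus_zero [simp]: "x \<in> carrier A \<Longrightarrow> \<parallel>x \<ominus> \<zero>\<parallel> = \<parallel>x\<parallel>"
  by (simp add: a_minus_def)

lemma cstar_tendsto_nearD:
  assumes "cstar_tendsto A \<sigma> l" "e > 0"
  obtains n where "\<parallel>\<sigma> n \<ominus> l\<parallel> < e"
  using order_tendstoD(2)[OF assms(1)[unfolded cstar_tendsto_def] assms(2)]
  unfolding eventually_sequentially by blast

lemma eq_if_near:
  assumes "x \<in> carrier A" "y \<in> carrier A" "\<And>e. e > 0 \<Longrightarrow> \<parallel>x \<ominus> y\<parallel> < e"
  shows "x = y"
proof (rule minus_eq_zeroD[OF assms(1,2)])
  have "\<parallel>x \<ominus> y\<parallel> \<le> 0" using assms(3) by (meson less_irrefl not_le)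
  then show "x \<ominus> y = \<zero>"
    using assms nrm_nonneg[of "x \<ominus> y"] nrm_eq_0[of "x \<ominus> y"] by simp
qed

lemma cstar_tendsto_contract:
  assumes "cstar_tendsto A \<sigma> l" "\<And>n. \<parallel>\<tau> n \<ominus>\<^bsub>B\<^esub> k\<parallel>\<^bsub>B\<^esub> \<le> C * \<parallel>\<sigma> n \<ominus> l\<parallel>"
    "\<And>n. 0 \<le> \<parallel>\<tau> n \<ominus>\<^bsub>B\<^esub> k\<parallel>\<^bsub>B\<^esub>"
  shows "cstar_tendsto B \<tau> k"
proof -
  have "(\<lambda>n. C * \<parallel>\<sigma> n \<ominus> l\<parallel>) \<longlonglongrightarrow> 0"
    using tendsto_mult_left[OF assms(1)[unfolded cstar_tendsto_def], of C] by simp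
  then show ?thesis
    unfolding cstar_tendsto_def by (rule Lim_null_comparison[rotated]) (use assms in auto)
qed

lemma cstar_tendsto_unique:
  assumes "cstar_tendsto A \<sigma> l" "cstar_tendsto A \<sigma> k"
    and "\<And>n. \<sigma> n \<in> carrier A" "l \<in> carrier A" "k \<in> carrier A"
  shows "l = k"
proof (rule eq_if_near)
  fix e :: real assume "e > 0"
  have "(\<lambda>n. \<parallel>\<sigma> n \<ominus> l\<parallel> + \<parallel>\<sigma> n \<ominus> k\<parallel>) \<longlonglongrightarrow> 0 + 0"
    using assms(1,2) unfolding cstar_tendsto_def by (rule tendsto_add)
  then have "\<forall>\<^sub>F n in sequentially. \<parallel>\<sigma> n \<ominus> l\<parallel> + \<parallel>\<sigma> n \<ominus> k\<parallel> < e"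
    using \<open>e > 0\<close> by (intro order_tendstoD(2)) auto
  then obtain n where "\<parallel>\<sigma> n \<ominus> l\<parallel> + \<parallel>\<sigma> n \<ominus> k\<parallel> < e"
    unfolding eventually_sequentially by blast
  then show "\<parallel>l \<ominus> k\<parallel> < e"
    using nrm_minus_triangle[of l "\<sigma> n" k] nrm_minus_commute[of l "\<sigma> n"] assms by simp
qed (use assms in auto)

lemma cstar_tendsto_mult_left:
  assumes "cstar_tendsto A \<sigma> l" "\<And>n. \<sigma> n \<in> carrier A" "l \<in> carrier A" "x \<in> carrier A"
  shows "cstar_tendsto A (\<lambda>n. x \<otimes> \<sigma> n) (x \<otimes> l)"
proof (rule cstar_tendsto_contract[OF assms(1)])
  show "\<parallel>x \<otimes> \<sigma> n \<ominus> x \<otimes> l\<parallel> \<le> \<parallel>x\<parallel> * \<parallel>\<sigma> n \<ominus> l\<parallel>" for n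
    using nrm_minus_mult[of x "\<sigma> n" x l] assms nrm_minus_self by simp
qed (use assms nrm_nonneg in simp)

lemma cstar_tendsto_mult_right:
  assumes "cstar_tendsto A \<sigma> l" "\<And>n. \<sigma> n \<in> carrier A" "l \<in> carrier A" "x \<in> carrier A"
  shows "cstar_tendsto A (\<lambda>n. \<sigma> n \<otimes> x) (l \<otimes> x)"
proof (rule cstar_tendsto_contract[OF assms(1)])
  show "\<parallel>\<sigma> n \<otimes> x \<ominus> l \<otimes> x\<parallel> \<le> \<parallel>x\<parallel> * \<parallel>\<sigma> n \<ominus> l\<parallel>" for n
    using nrm_minus_mult[of "\<sigma> n" x l x] assms nrm_minus_self by (simp add: mult.commute)
qed (use assms nrm_nonneg in simp)

lemma cstar_tendsto_adj:
  assumes "cstar_tendsto A \<sigma> l" "\<And>n. \<sigma> n \<in> carrier A" "l \<in> carrier A"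
  shows "cstar_tendsto A (\<lambda>n. (\<sigma> n)\<^sup>\<star>) (l\<^sup>\<star>)"
  using assms nrm_minus_adj unfolding cstar_tendsto_def by simp

section \<open>Automatic contractivity of *-homomorphisms\<close>

text \<open>The square root is \<open>1 - z\<close> for the fixed point \<open>z\<close> of \<open>w \<mapsto> (y + w\<^sup>2) / 2\<close>, because \<open>2 z = y + z\<^sup>2\<close>
  says \<open>(1 - z)\<^sup>2 = 1 - y\<close>.  The iterates from 0 are polynomials in \<open>y\<close>, so self-adjointness and
  commutation with everything that commutes with \<open>y\<close> pass to the limit.\<close>

lemma sqrt_one_minus:
  assumes y: "y \<in> carrier A" "y\<^sup>\<star> = y" "\<parallel>y\<parallel> < 1"
  obtains s where "s \<in> carrier A" "s\<^sup>\<star> = s" "s \<otimes> s = \<one> \<ominus> y"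
    "\<And>h. \<lbrakk>h \<in> carrier A; h \<otimes> y = y \<otimes> h\<rbrakk> \<Longrightarrow> h \<otimes> s = s \<otimes> h"
proof -
  \<comment> \<open>The scalar fixed point: the iteration keeps the ball of radius \<open>\<rho>\<close> and has Lipschitz
    constant \<open>\<rho> < 1\<close> on it.\<close>
  define \<rho> where "\<rho> = 1 - sqrt (1 - \<parallel>y\<parallel>)"
  have \<rho>: "0 \<le> \<rho>" "\<rho> < 1" "\<parallel>y\<parallel> + \<rho> * \<rho> = 2 * \<rho>"
    using y(3) nrm_nonneg[OF y(1)] by (simp_all add: \<rho>_def algebra_simps)
  define g where "g w = (1/2) \<odot> (y \<oplus> w \<otimes> w)" for w
  have gc: "g w \<in> carrier A" if "w \<in> carrier A" for w using that y by (simp add: g_def)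
  have gb: "\<parallel>g w\<parallel> \<le> \<rho>" if w: "w \<in> carrier A" "\<parallel>w\<parallel> \<le> \<rho>" for w
  proof -
    have "\<parallel>w \<otimes> w\<parallel> \<le> \<rho> * \<rho>"
      using nrm_mult[OF w(1) w(1)] mult_mono[OF w(2) w(2)] \<rho> nrm_nonneg[OF w(1)] by simp
    then have "\<parallel>y \<oplus> w \<otimes> w\<parallel> \<le> 2 * \<rho>" using nrm_triangle[of y "w \<otimes> w"] y w \<rho> by simp
    then show ?thesis using y w by (simp add: g_def nrm_smult)
  qed
  have glip: "\<parallel>g v \<ominus> g w\<parallel> \<le> \<rho> * \<parallel>v \<ominus> w\<parallel>"
    if v: "v \<in> carrier A" "\<parallel>v\<parallel> \<le> \<rho>" and w: "w \<in> carrier A" "\<parallel>w\<parallel> \<le> \<rho>" for v w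
  proof -
    have "\<parallel>v \<otimes> v \<ominus> w \<otimes> w\<parallel> \<le> \<parallel>v \<ominus> w\<parallel> * \<parallel>v\<parallel> + \<parallel>w\<parallel> * \<parallel>v \<ominus> w\<parallel>"
      using nrm_minus_mult[of v v w w] v w by simp
    also have "\<dots> \<le> \<parallel>v \<ominus> w\<parallel> * \<rho> + \<rho> * \<parallel>v \<ominus> w\<parallel>"
      using v w nrm_nonneg[of "v \<ominus> w"] by (intro add_mono mult_left_mono mult_right_mono) auto
    finally have "\<parallel>v \<otimes> v \<ominus> w \<otimes> w\<parallel> \<le> 2 * \<rho> * \<parallel>v \<ominus> w\<parallel>" by simp
    then have "\<parallel>(y \<oplus> v \<otimes> v) \<ominus> (y \<oplus> w \<otimes> w)\<parallel> \<le> 2 * \<rho> * \<parallel>v \<ominus> w\<parallel>"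
      using nrm_minus_add[of y "v \<otimes> v" y "w \<otimes> w"] nrm_minus_self[of y] v w y by simp
    then show ?thesis
      using nrm_minus_smult[of "y \<oplus> v \<otimes> v" "y \<oplus> w \<otimes> w" "1/2" "1/2"] v w y by (simp add: g_def)
  qed
  define z where "z n = (g ^^ n) \<zero>" for n
  have z0: "z 0 = \<zero>" and zS: "z (Suc n) = g (z n)" for n by (simp_all add: z_def)
  have zc: "z n \<in> carrier A \<and> \<parallel>z n\<parallel> \<le> \<rho>" for n
    by (induction n) (use z0 zS gc gb \<rho> in auto)
  have d: "\<parallel>z (n + k) \<ominus> z n\<parallel> \<le> \<rho> ^ n" for n k
  proof (induction n)
    case 0 then show ?case using zc[of k] \<rho> z0 by simp
  next
    case (Suc n)
    have "\<parallel>z (Suc n + k) \<ominus> z (Suc n)\<parallel> \<le> \<rho> * \<parallel>z (n + k) \<ominus> z n\<parallel>"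
      using glip[of "z (n+k)" "z n"] zc zS by simp
    also have "\<dots> \<le> \<rho> * \<rho> ^ n" using Suc \<rho> by (intro mult_left_mono)
    finally show ?case by simp
  qed
  have "cstar_Cauchy A z"
    unfolding cstar_Cauchy_def
  proof (intro allI impI)
    fix e :: real assume "e > 0"
    then obtain N where N: "\<rho> ^ N < e / 2"
      using real_arch_pow_inv[of "e/2" \<rho>] \<rho> by auto
    have "\<parallel>z m \<ominus> z n\<parallel> < e" if mn: "m \<ge> N" "n \<ge> N" for m n
    proof -
      have "\<parallel>z m \<ominus> z N\<parallel> \<le> \<rho> ^ N" "\<parallel>z n \<ominus> z N\<parallel> \<le> \<rho> ^ N"
        using d[of N "m - N"] d[of N "n - N"] mn by simp_all
      then show ?thesis
        using nrm_minus_triangle[of "z m" "z N" "z n"] nrm_minus_commute[of "z n" "z N"] zc N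
        by fastforce
    qed
    then show "\<exists>N. \<forall>m\<ge>N. \<forall>n\<ge>N. \<parallel>z m \<ominus> z n\<parallel> < e" by blast
  qed
  then obtain l where l: "l \<in> carrier A" "cstar_tendsto A z l" using complete zc by blast
  have lb: "\<parallel>l\<parallel> \<le> \<rho>"
  proof (rule field_le_epsilon)
    fix e :: real assume "e > 0"
    then obtain n where "\<parallel>z n \<ominus> l\<parallel> < e" using cstar_tendsto_nearD[OF l(2)] by blast
    then show "\<parallel>l\<parallel> \<le> \<rho> + e"
      using nrm_minus_triangle[of l "z n" \<zero>] nrm_minus_commute[of l "z n"] zc[of n] l(1) by simp
  qed
  have "cstar_tendsto A (\<lambda>n. z (Suc n)) (g l)"
    unfolding zS by (rule cstar_tendsto_contract[OF l(2), where C = \<rho>])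
      (use glip zc l lb gc nrm_nonneg in auto)
  moreover have "cstar_tendsto A (\<lambda>n. z (Suc n)) l"
    using l(2) unfolding cstar_tendsto_def by (rule LIMSEQ_Suc)
  ultimately have "g l = l" using cstar_tendsto_unique[of "\<lambda>n. z (Suc n)"] zc l(1) gc by blast
  then have "l \<oplus> l = (1/2) \<odot> (y \<oplus> l \<otimes> l) \<oplus> (1/2) \<odot> (y \<oplus> l \<otimes> l)" by (simp add: g_def)
  also have "\<dots> = y \<oplus> l \<otimes> l"
    using y l(1) smult_l_distr[of "y \<oplus> l \<otimes> l" "1/2" "1/2", symmetric] by (simp add: smult_one)
  finally have fixp: "y \<oplus> l \<otimes> l = l \<oplus> l" by simp
  have zadj: "(z n)\<^sup>\<star> = z n" for n
    by (induction n) (use y zc in \<open>simp_all add: z0 zS g_def adj_smult adj_add adj_mult\<close>)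
  have ladj: "l\<^sup>\<star> = l"
    using cstar_tendsto_unique[OF cstar_tendsto_adj[OF l(2)], of l] zadj zc l by simp
  define s where "s = \<one> \<ominus> l"
  have sc: "s \<in> carrier A" using l by (simp add: s_def)
  have "s\<^sup>\<star> = s"
    using l ladj adj_smult[OF l(1), of "-1"]
    by (simp add: s_def a_minus_def adj_add a_inv_smult)
  moreover have "s \<otimes> s = \<one> \<ominus> y"
  proof -
    have "s \<otimes> s = \<one> \<oplus> l \<otimes> l \<ominus> (l \<oplus> l)"
      using l by (simp add: s_def a_minus_def l_distr r_distr l_minus r_minus minus_add a_ac)
    also have "\<dots> = \<one> \<ominus> y"
      using l y by (simp flip: fixp add: a_minus_def minus_add) (simp add: a_ac r_neg1 r_neg)
    finally show ?thesis .
  qed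
  moreover have "h \<otimes> s = s \<otimes> h" if h: "h \<in> carrier A" "h \<otimes> y = y \<otimes> h" for h
  proof -
    have "h \<otimes> z n = z n \<otimes> h" for n
    proof (induction n)
      case (Suc n)
      have "h \<otimes> (z n \<otimes> z n) = (z n \<otimes> z n) \<otimes> h"
        using zc h Suc by (metis m_assoc)
      then show ?case using zc[of n] h y by (simp add: zS g_def smult_mult_l smult_mult_r l_distr r_distr)
    qed (use h z0 in simp)
    then have "h \<otimes> l = l \<otimes> h"
      using cstar_tendsto_unique[OF cstar_tendsto_mult_left[OF l(2)] , of h "l \<otimes> h"]
        cstar_tendsto_mult_right[OF l(2), of h] zc l h by simp
    then show ?thesis using h l by (simp add: s_def a_minus_def l_distr r_distr l_minus r_minus)
  qed
  ultimately show ?thesis using that sc by blast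
qed

text \<open>A self-adjoint \<open>h\<close> of norm less than 1 is the mean of \<open>u = h + \<i> sqrt (1 - h\<^sup>2)\<close> and its adjoint, and
  \<open>u\<^sup>\<star> u = 1\<close>.  A *-homomorphism preserves this equation, so it sends \<open>u\<close> to an element of norm at
  most 1, and \<open>h\<close> as well.  The C*-identity carries this from \<open>x\<^sup>\<star> x\<close> to an arbitrary \<open>x\<close>; no spectral
  theory enters.\<close>

lemma star_hom_contractive:
  assumes B: "cstar_algebra B" and \<phi>: "\<phi> \<in> star_hom A B" and x: "x \<in> carrier A"
  shows "\<parallel>\<phi> x\<parallel>\<^bsub>B\<^esub> \<le> \<parallel>x\<parallel>"
proof -
  interpret B: cstar_algebra B by fact
  have hom: "\<And>x. x \<in> carrier A \<Longrightarrow> \<phi> x \<in> carrier B"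
    "\<And>x y. \<lbrakk>x \<in> carrier A; y \<in> carrier A\<rbrakk> \<Longrightarrow> \<phi> (x \<otimes> y) = \<phi> x \<otimes>\<^bsub>B\<^esub> \<phi> y"
    "\<And>x y. \<lbrakk>x \<in> carrier A; y \<in> carrier A\<rbrakk> \<Longrightarrow> \<phi> (x \<oplus> y) = \<phi> x \<oplus>\<^bsub>B\<^esub> \<phi> y"
    "\<phi> \<one> = \<one>\<^bsub>B\<^esub>"
    "\<And>a x. x \<in> carrier A \<Longrightarrow> \<phi> (a \<odot> x) = a \<odot>\<^bsub>B\<^esub> \<phi> x"
    "\<And>x. x \<in> carrier A \<Longrightarrow> \<phi> (x\<^sup>\<star>) = (\<phi> x)\<^sup>\<star>\<^bsub>B\<^esub>"
    using \<phi> unfolding star_hom_def ring_hom_def by auto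
  have unit: "\<parallel>\<phi> h\<parallel>\<^bsub>B\<^esub> \<le> 1" if h: "h \<in> carrier A" "h\<^sup>\<star> = h" "\<parallel>h\<parallel> < 1" for h
  proof -
    have "(h \<otimes> h)\<^sup>\<star> = h \<otimes> h" using h by (simp add: adj_mult)
    moreover have "\<parallel>h \<otimes> h\<parallel> < 1"
      using cstar_identity[OF h(1)] h nrm_nonneg[OF h(1)] by (simp add: power_less_one_iff abs_square_less_1)
    ultimately obtain s where s: "s \<in> carrier A" "s\<^sup>\<star> = s" "s \<otimes> s = \<one> \<ominus> h \<otimes> h" "h \<otimes> s = s \<otimes> h"
      using sqrt_one_minus[of "h \<otimes> h"] h m_assoc by (metis m_closed)
    define u where "u = h \<oplus> \<i> \<odot> s"
    have u: "u \<in> carrier A" "u\<^sup>\<star> = h \<oplus> (-\<i>) \<odot> s"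
      using h s by (simp_all add: u_def adj_add adj_smult)
    have "u\<^sup>\<star> \<otimes> u = (h \<otimes> h \<oplus> s \<otimes> s) \<oplus> (\<i> \<odot> (s \<otimes> h) \<oplus> (-\<i>) \<odot> (s \<otimes> h))"
      unfolding u(2) using h s(1,4)
      by (simp add: u_def l_distr r_distr smult_r_distr smult_mult_l smult_mult_r
          smult_assoc[symmetric] smult_one a_ac)
    also have "h \<otimes> h \<oplus> s \<otimes> s = \<one>"
      using h s by (simp add: a_minus_def a_ac r_neg1) (simp add: r_neg2 a_lcomm r_neg)
    also have "\<i> \<odot> (s \<otimes> h) \<oplus> (-\<i>) \<odot> (s \<otimes> h) = \<zero>"
      using h s smult_l_distr[of "s \<otimes> h" \<i> "-\<i>"] smult_zero_left by simp
    finally have "u\<^sup>\<star> \<otimes> u = \<one>" by simp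
    then have "(\<phi> u)\<^sup>\<star>\<^bsub>B\<^esub> \<otimes>\<^bsub>B\<^esub> \<phi> u = \<one>\<^bsub>B\<^esub>" using hom u by (metis adj_closed)
    then have n: "\<parallel>\<phi> u\<parallel>\<^bsub>B\<^esub> \<le> 1" using B.nrm_isometry_le hom u by blast
    have "u \<oplus> u\<^sup>\<star> = h \<oplus> h \<oplus> (\<i> \<odot> s \<oplus> (-\<i>) \<odot> s)"
      using h s by (simp add: u(2)) (simp add: u_def a_ac)
    also have "\<dots> = 2 \<odot> h"
      using h s smult_l_distr[of s \<i> "-\<i>"] smult_l_distr[of h 1 1] smult_zero_left
      by (simp add: smult_one)
    finally have "2 \<odot> h = u \<oplus> u\<^sup>\<star>" by simp
    then have "\<phi> (2 \<odot> h) = \<phi> (u \<oplus> u\<^sup>\<star>)" by simp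
    then have "2 \<odot>\<^bsub>B\<^esub> \<phi> h = \<phi> u \<oplus>\<^bsub>B\<^esub> (\<phi> u)\<^sup>\<star>\<^bsub>B\<^esub>" using hom h u by (metis adj_closed)
    then have "2 * \<parallel>\<phi> h\<parallel>\<^bsub>B\<^esub> \<le> \<parallel>\<phi> u\<parallel>\<^bsub>B\<^esub> + \<parallel>(\<phi> u)\<^sup>\<star>\<^bsub>B\<^esub>\<parallel>\<^bsub>B\<^esub>"
      using B.nrm_smult[of "\<phi> h" 2] B.nrm_triangle[of "\<phi> u" "(\<phi> u)\<^sup>\<star>\<^bsub>B\<^esub>"] hom h u by simp
    then show ?thesis using B.nrm_adj[of "\<phi> u"] n hom u by simp
  qed
  show ?thesis
  proof (rule ccontr)
    assume "\<not> \<parallel>\<phi> x\<parallel>\<^bsub>B\<^esub> \<le> \<parallel>x\<parallel>"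
    then obtain t where t: "\<parallel>x\<parallel> < t" "t < \<parallel>\<phi> x\<parallel>\<^bsub>B\<^esub>" using dense not_le by blast
    then have t0: "t > 0" using nrm_nonneg[OF x] by simp
    define h where "h = complex_of_real (1 / t\<^sup>2) \<odot> (x\<^sup>\<star> \<otimes> x)"
    have h: "h \<in> carrier A" "h\<^sup>\<star> = h" using x by (simp_all add: h_def adj_smult adj_mult)
    have "\<parallel>h\<parallel> = \<parallel>x\<parallel>\<^sup>2 / t\<^sup>2"
      using x t0 cstar_identity[OF x] by (simp add: h_def nrm_smult norm_divide norm_power)
    also have "\<dots> < 1" using t t0 nrm_nonneg[OF x] by (simp add: power_strict_mono)
    finally have "\<parallel>\<phi> h\<parallel>\<^bsub>B\<^esub> \<le> 1" using unit h by blast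
    moreover have "\<phi> h = complex_of_real (1 / t\<^sup>2) \<odot>\<^bsub>B\<^esub> ((\<phi> x)\<^sup>\<star>\<^bsub>B\<^esub> \<otimes>\<^bsub>B\<^esub> \<phi> x)"
      unfolding h_def using hom x by simp
    then have "\<parallel>\<phi> h\<parallel>\<^bsub>B\<^esub> = (\<parallel>\<phi> x\<parallel>\<^bsub>B\<^esub>)\<^sup>2 / t\<^sup>2"
      using x t0 hom B.cstar_identity[of "\<phi> x"]
      by (simp add: B.nrm_smult norm_divide norm_power)
    moreover have "(\<parallel>\<phi> x\<parallel>\<^bsub>B\<^esub>)\<^sup>2 > t\<^sup>2" using t t0 by (simp add: power_strict_mono)
    ultimately show False using t0 by (simp add: field_simps)
  qed
qed

lemma star_homD:
  assumes "\<phi> \<in> star_hom A B"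
  shows "x \<in> carrier A \<Longrightarrow> \<phi> x \<in> carrier B"
    and "\<lbrakk>x \<in> carrier A; y \<in> carrier A\<rbrakk> \<Longrightarrow> \<phi> (x \<otimes> y) = \<phi> x \<otimes>\<^bsub>B\<^esub> \<phi> y"
    and "\<lbrakk>x \<in> carrier A; y \<in> carrier A\<rbrakk> \<Longrightarrow> \<phi> (x \<oplus> y) = \<phi> x \<oplus>\<^bsub>B\<^esub> \<phi> y"
    and "\<phi> \<one> = \<one>\<^bsub>B\<^esub>"
    and "x \<in> carrier A \<Longrightarrow> \<phi> (a \<odot> x) = a \<odot>\<^bsub>B\<^esub> \<phi> x"
    and "x \<in> carrier A \<Longrightarrow> \<phi> (x\<^sup>\<star>) = (\<phi> x)\<^sup>\<star>\<^bsub>B\<^esub>"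
  using assms unfolding star_hom_def ring_hom_def by auto

lemma star_hom_tendsto:
  assumes B: "cstar_algebra B" and \<phi>: "\<phi> \<in> star_hom A B"
    and \<sigma>: "cstar_tendsto A \<sigma> l" "\<And>n. \<sigma> n \<in> carrier A" "l \<in> carrier A"
  shows "cstar_tendsto B (\<lambda>n. \<phi> (\<sigma> n)) (\<phi> l)"
proof -
  interpret B: cstar_algebra B by fact
  have minus: "\<phi> x \<ominus>\<^bsub>B\<^esub> \<phi> y = \<phi> (x \<ominus> y)" if "x \<in> carrier A" "y \<in> carrier A" for x y
    using that by (simp add: a_minus_def a_inv_smult B.a_inv_smult star_homD[OF \<phi>])
  show ?thesis
    by (rule cstar_tendsto_contract[OF \<sigma>(1), where C = 1])
      (use \<sigma> minus star_hom_contractive[OF B \<phi>] B.nrm_nonneg star_homD(1)[OF \<phi>] in auto)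
qed

section \<open>*-homomorphisms on generated subalgebras\<close>

text \<open>Contractivity makes the preimage of a C*-subalgebra norm closed, hence a C*-subalgebra.\<close>

lemma star_hom_generated_image:
  assumes B: "cstar_algebra B" and \<phi>: "\<phi> \<in> star_hom A B" and X: "X \<subseteq> carrier A"
    and K: "cstar_subalgebra K B" "\<phi> ` X \<subseteq> K" and x: "x \<in> cstar_generated A X"
  shows "\<phi> x \<in> K"
proof -
  note hom = star_homD[OF \<phi>]
  have K': "\<one>\<^bsub>B\<^esub> \<in> K" "\<And>x y. \<lbrakk>x \<in> K; y \<in> K\<rbrakk> \<Longrightarrow> x \<oplus>\<^bsub>B\<^esub> y \<in> K \<and> x \<otimes>\<^bsub>B\<^esub> y \<in> K"
    "\<And>a x. x \<in> K \<Longrightarrow> a \<odot>\<^bsub>B\<^esub> x \<in> K" "\<And>x. x \<in> K \<Longrightarrow> x\<^sup>\<star>\<^bsub>B\<^esub> \<in> K"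
    "\<And>\<sigma> l. \<lbrakk>l \<in> carrier B; \<And>n. \<sigma> n \<in> K; cstar_tendsto B \<sigma> l\<rbrakk> \<Longrightarrow> l \<in> K"
    using K(1) unfolding cstar_subalgebra_def by blast+
  have "cstar_subalgebra {x \<in> carrier A. \<phi> x \<in> K} A"
    unfolding cstar_subalgebra_def
  proof (intro conjI allI ballI impI)
    fix \<sigma> l assume l: "l \<in> carrier A" and "(\<forall>n. \<sigma> n \<in> {x \<in> carrier A. \<phi> x \<in> K}) \<and> cstar_tendsto A \<sigma> l"
    then show "l \<in> {x \<in> carrier A. \<phi> x \<in> K}"
      using K'(5)[of "\<phi> l" "\<lambda>n. \<phi> (\<sigma> n)"] star_hom_tendsto[OF B \<phi>, of \<sigma> l] hom(1) by simp
  qed (use K' hom in auto)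
  then show ?thesis using x X K(2) unfolding cstar_generated_def by blast
qed

text \<open>The domain is the generated subalgebra only, since the automorphisms of \<open>\<O>\<^sub>2\<close> to which this applies
  are not assumed to come from the ambient algebra.  Contractivity makes the equalizer closed.\<close>

lemma star_hom_eq_on_generated:
  assumes B: "cstar_algebra B" and X: "X \<subseteq> carrier A"
    and f: "f \<in> star_hom (A\<lparr>carrier := cstar_generated A X\<rparr>) B"
    and g: "g \<in> star_hom (A\<lparr>carrier := cstar_generated A X\<rparr>) B"
    and eq: "\<And>x. x \<in> X \<Longrightarrow> f x = g x" and x: "x \<in> cstar_generated A X"
  shows "f x = g x"
proof -
  let ?H = "cstar_generated A X" and ?G = "A\<lparr>carrier := cstar_generated A X\<rparr>"
  note H = cstar_subalgebra_generated[OF X]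
  interpret B: cstar_algebra B by fact
  interpret G: cstar_algebra ?G by (rule cstar_algebra_restrict[OF H(1)])
  have H': "?H \<subseteq> carrier A" "\<one> \<in> ?H" "\<And>x y. \<lbrakk>x \<in> ?H; y \<in> ?H\<rbrakk> \<Longrightarrow> x \<oplus> y \<in> ?H \<and> x \<otimes> y \<in> ?H"
    "\<And>a x. x \<in> ?H \<Longrightarrow> a \<odot> x \<in> ?H" "\<And>x. x \<in> ?H \<Longrightarrow> x\<^sup>\<star> \<in> ?H"
    "\<And>\<sigma> l. \<lbrakk>l \<in> carrier A; \<And>n. \<sigma> n \<in> ?H; cstar_tendsto A \<sigma> l\<rbrakk> \<Longrightarrow> l \<in> ?H"
    using H(1) unfolding cstar_subalgebra_def by blast+
  have minus: "x \<ominus>\<^bsub>?G\<^esub> y = x \<ominus> y" if "x \<in> ?H" "y \<in> ?H" for x y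
    using that G.a_inv_smult[of y] a_inv_smult[of y] H' by (auto simp: a_minus_def)
  have lim: "cstar_tendsto ?G \<sigma> l" if "cstar_tendsto A \<sigma> l" "\<And>n. \<sigma> n \<in> ?H" "l \<in> ?H" for \<sigma> l
    using that minus unfolding cstar_tendsto_def by simp
  have "cstar_subalgebra {x \<in> ?H. f x = g x} A"
    unfolding cstar_subalgebra_def
  proof (intro conjI allI ballI impI)
    fix \<sigma> l assume l: "l \<in> carrier A" and \<sigma>: "(\<forall>n. \<sigma> n \<in> {x \<in> ?H. f x = g x}) \<and> cstar_tendsto A \<sigma> l"
    then have lH: "l \<in> ?H" using H'(6)[of l \<sigma>] by simp
    have limG: "cstar_tendsto ?G \<sigma> l" using lim \<sigma> lH by simp
    have "cstar_tendsto B (\<lambda>n. f (\<sigma> n)) (f l)"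
      using G.star_hom_tendsto[OF B f limG] \<sigma> lH by simp
    moreover have "cstar_tendsto B (\<lambda>n. g (\<sigma> n)) (g l)"
      using G.star_hom_tendsto[OF B g limG] \<sigma> lH by simp
    then have "cstar_tendsto B (\<lambda>n. f (\<sigma> n)) (g l)" using \<sigma> by simp
    ultimately have "f l = g l"
      by (rule B.cstar_tendsto_unique) (use \<sigma> lH G.star_homD(1)[OF f] G.star_homD(1)[OF g] in simp_all)
    then show "l \<in> {x \<in> ?H. f x = g x}" using lH by simp
  qed (use H' G.star_homD[OF f] G.star_homD[OF g] in auto)
  then show ?thesis using x X eq H(2) unfolding cstar_generated_def by blast
qed

section \<open>Closed subspaces containing a generated subalgebra\<close>

definition closed_subspace :: "'a set \<Rightarrow> bool" where
  "closed_subspace N \<longleftrightarrow> N \<subseteq> carrier A \<and> \<zero> \<in> N \<and> (\<forall>x\<in>N. \<forall>y\<in>N. x \<oplus> y \<in> N) \<and>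
     (\<forall>c. \<forall>x\<in>N. c \<odot> x \<in> N) \<and>
     (\<forall>\<sigma>. \<forall>l\<in>carrier A. (\<forall>n. \<sigma> n \<in> N) \<and> cstar_tendsto A \<sigma> l \<longrightarrow> l \<in> N)"

lemma closed_subspaceI:
  assumes "N \<subseteq> carrier A" "\<zero> \<in> N" "\<And>x y. \<lbrakk>x \<in> N; y \<in> N\<rbrakk> \<Longrightarrow> x \<oplus> y \<in> N"
    "\<And>c x. x \<in> N \<Longrightarrow> c \<odot> x \<in> N"
    "\<And>\<sigma> l. \<lbrakk>l \<in> carrier A; \<And>n. \<sigma> n \<in> N; cstar_tendsto A \<sigma> l\<rbrakk> \<Longrightarrow> l \<in> N"
  shows "closed_subspace N"
  using assms unfolding closed_subspace_def by blast

lemma closed_subspaceD: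
  assumes "closed_subspace N"
  shows "x \<in> N \<Longrightarrow> x \<in> carrier A" "\<zero> \<in> N" "\<lbrakk>x \<in> N; y \<in> N\<rbrakk> \<Longrightarrow> x \<oplus> y \<in> N"
    "x \<in> N \<Longrightarrow> c \<odot> x \<in> N"
    "\<lbrakk>l \<in> carrier A; \<And>n. \<sigma> n \<in> N; cstar_tendsto A \<sigma> l\<rbrakk> \<Longrightarrow> l \<in> N"
  using assms unfolding closed_subspace_def by blast+

lemma closed_subspace_left_preimage:
  assumes N: "closed_subspace N" and x: "x \<in> carrier A"
  shows "closed_subspace {y \<in> carrier A. x \<otimes> y \<in> N}"
proof (rule closed_subspaceI)
  fix \<sigma> l assume l: "l \<in> carrier A" and \<sigma>: "\<And>n. \<sigma> n \<in> {y \<in> carrier A. x \<otimes> y \<in> N}"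
    and lim: "cstar_tendsto A \<sigma> l"
  have "x \<otimes> l \<in> N"
    by (rule closed_subspaceD(5)[OF N _ _ cstar_tendsto_mult_left[OF lim]]) (use l \<sigma> x in auto)
  then show "l \<in> {y \<in> carrier A. x \<otimes> y \<in> N}" using l by simp
qed (use x closed_subspaceD(1-4)[OF N] in \<open>auto simp: r_distr smult_mult_r\<close>)

text \<open>Let \<open>K\<close> be the closed linear span of \<open>M\<close>.  The elements \<open>x\<close> for which \<open>x\<close> and \<open>x\<^sup>\<star>\<close> both multiply \<open>K\<close>
  into itself from the left form a C*-subalgebra, whatever \<open>K\<close> is.  It contains \<open>X\<close>, and it is
  contained in \<open>K\<close> because \<open>K\<close> contains 1.  This avoids any multiplication table for \<open>M\<close>.\<close>

lemma generated_subset_closed_subspace: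
  assumes X: "X \<subseteq> carrier A" and M: "M \<subseteq> carrier A" "\<one> \<in> M"
    and left: "\<And>g v. \<lbrakk>g \<in> X; v \<in> M\<rbrakk> \<Longrightarrow> g \<otimes> v \<in> M \<and> g\<^sup>\<star> \<otimes> v \<in> M"
    and N: "closed_subspace N" "M \<subseteq> N"
  shows "cstar_generated A X \<subseteq> N"
proof -
  define K where "K = {x \<in> carrier A. \<forall>N. closed_subspace N \<and> M \<subseteq> N \<longrightarrow> x \<in> N}"
  have KN: "K \<subseteq> N'" if "closed_subspace N'" "M \<subseteq> N'" for N'
    using that unfolding K_def by blast
  have MK: "M \<subseteq> K" using M(1) unfolding K_def by blast
  have K: "closed_subspace K"
  proof (rule closed_subspaceI)
    fix \<sigma> l assume l: "l \<in> carrier A" and \<sigma>: "\<And>n. \<sigma> n \<in> K" "cstar_tendsto A \<sigma> l"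
    have "l \<in> N'" if N': "closed_subspace N'" "M \<subseteq> N'" for N'
      using closed_subspaceD(5)[OF N'(1) l _ \<sigma>(2)] KN[OF N'] \<sigma>(1) by blast
    then show "l \<in> K" using l unfolding K_def by blast
  qed (unfold K_def, auto dest: closed_subspaceD(2-4))
  note KD = closed_subspaceD[OF K]
  have gK: "g \<otimes> y \<in> K" if g: "g \<in> carrier A" "\<And>v. v \<in> M \<Longrightarrow> g \<otimes> v \<in> M" and y: "y \<in> K" for g y
    using KN[OF closed_subspace_left_preimage[OF K g(1)]] g M MK y by blast
  define H where "H = {x \<in> carrier A. \<forall>y\<in>K. x \<otimes> y \<in> K \<and> x\<^sup>\<star> \<otimes> y \<in> K}"
  have "cstar_subalgebra H A"
    unfolding cstar_subalgebra_def
  proof (intro conjI allI ballI impI)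
    fix \<sigma> l assume l: "l \<in> carrier A" and \<sigma>: "(\<forall>n. \<sigma> n \<in> H) \<and> cstar_tendsto A \<sigma> l"
    then have \<sigma>c: "\<sigma> n \<in> carrier A" for n unfolding H_def by blast
    have "l \<otimes> y \<in> K \<and> l\<^sup>\<star> \<otimes> y \<in> K" if y: "y \<in> K" for y
    proof
      show "l \<otimes> y \<in> K"
        by (rule KD(5)[OF _ _ cstar_tendsto_mult_right[of \<sigma>]])
          (use \<sigma> \<sigma>c l y KD(1) in \<open>auto simp: H_def\<close>)
      show "l\<^sup>\<star> \<otimes> y \<in> K"
        by (rule KD(5)[OF _ _ cstar_tendsto_mult_right[OF cstar_tendsto_adj[of \<sigma> l]]])
          (use \<sigma> \<sigma>c l y KD(1) in \<open>auto simp: H_def\<close>)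
    qed
    then show "l \<in> H" using l unfolding H_def by blast
  qed (use KD(1-4) in \<open>auto simp: H_def l_distr smult_mult_l adj_add adj_smult adj_mult m_assoc\<close>)
  moreover have "X \<subseteq> H"
    using X left gK unfolding H_def by auto
  ultimately have "cstar_generated A X \<subseteq> H" unfolding cstar_generated_def by blast
  moreover have "H \<subseteq> K"
  proof
    fix x assume "x \<in> H"
    then have "x \<in> carrier A" "x \<otimes> \<one> \<in> K" using M(2) MK unfolding H_def by blast+
    then show "x \<in> K" by simp
  qed
  ultimately show ?thesis using KN[OF N] by blast
qed

section \<open>Elements absorbed by iterated compression\<close>

definition eigenspace :: "'a \<Rightarrow> 'a \<Rightarrow> complex \<Rightarrow> 'a set" where
  "eigenspace K R r = {y \<in> carrier A. K \<otimes> y \<otimes> R = r \<odot> y}"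

text \<open>The elements that some compression \<open>x \<mapsto> K\<^sup>m x R\<^sup>n\<close> moves arbitrarily close to the \<open>r\<close>-eigenspace of
  \<open>x \<mapsto> K x R\<close>.  The exponents \<open>m\<close> and \<open>n\<close> are independent, which allows words in the generators with
  different numbers of isometries on the left and on the right to be treated one side at a time.\<close>

definition absorbed :: "'a \<Rightarrow> 'a \<Rightarrow> complex \<Rightarrow> 'a set" where
  "absorbed K R r = {x \<in> carrier A. \<forall>e>0. \<exists>m n. \<exists>y\<in>eigenspace K R r.
     \<parallel>K [^] (m::nat) \<otimes> x \<otimes> R [^] (n::nat) \<ominus> y\<parallel> < e}"

context
  fixes K R :: 'a and r :: complex
  assumes K: "K \<in> carrier A" "\<parallel>K\<parallel> \<le> 1"
    and R: "R \<in> carrier A" "\<parallel>R\<parallel> \<le> 1"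
begin

lemma eigenspace_invariant:
  shows "eigenspace K R r \<subseteq> carrier A" "\<zero> \<in> eigenspace K R r"
    "\<And>x y. \<lbrakk>x \<in> eigenspace K R r; y \<in> eigenspace K R r\<rbrakk> \<Longrightarrow> x \<oplus> y \<in> eigenspace K R r"
    "\<And>c y. y \<in> eigenspace K R r \<Longrightarrow> c \<odot> y \<in> eigenspace K R r"
    "\<And>y. y \<in> eigenspace K R r \<Longrightarrow> K \<otimes> y \<in> eigenspace K R r"
    "\<And>y. y \<in> eigenspace K R r \<Longrightarrow> y \<otimes> R \<in> eigenspace K R r"
proof -
  show "eigenspace K R r \<subseteq> carrier A" "\<zero> \<in> eigenspace K R r" using K(1) R(1) by (auto simp: eigenspace_def)
  show "x \<oplus> y \<in> eigenspace K R r" if "x \<in> eigenspace K R r" "y \<in> eigenspace K R r" for x y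
    using that K(1) R(1) by (simp add: eigenspace_def l_distr r_distr smult_r_distr)
  show "c \<odot> y \<in> eigenspace K R r" if "y \<in> eigenspace K R r" for c y
    using that K(1) R(1) by (simp add: eigenspace_def smult_mult_l smult_mult_r)
      (simp add: smult_assoc[symmetric] mult.commute)
  fix y assume "y \<in> eigenspace K R r"
  then have y: "y \<in> carrier A" "K \<otimes> y \<otimes> R = r \<odot> y" by (simp_all add: eigenspace_def)
  have "K \<otimes> (K \<otimes> y) \<otimes> R = K \<otimes> (K \<otimes> y \<otimes> R)" using y(1) K(1) R(1) by (simp add: m_assoc)
  then show "K \<otimes> y \<in> eigenspace K R r" using y K(1) R(1) by (simp add: eigenspace_def smult_mult_r)
  have "K \<otimes> (y \<otimes> R) \<otimes> R = (K \<otimes> y \<otimes> R) \<otimes> R" using y(1) K(1) R(1) by (simp add: m_assoc)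
  then show "y \<otimes> R \<in> eigenspace K R r" using y K(1) R(1) by (simp add: eigenspace_def smult_mult_l)
qed

lemma compression_add:
  assumes "x \<in> carrier A"
  shows "K [^] (m + m' :: nat) \<otimes> x \<otimes> R [^] (n + n' :: nat) =
    K [^] m' \<otimes> (K [^] m \<otimes> x \<otimes> R [^] n) \<otimes> R [^] n'"
  using assms K(1) R(1)
  by (simp add: nat_pow_mult[symmetric] m_assoc) (simp add: m_assoc[symmetric] nat_pow_mult add.commute)

lemma contraction_power:
  assumes "x \<in> carrier A" "\<parallel>x\<parallel> \<le> 1"
  shows "\<parallel>x [^] (n::nat)\<parallel> \<le> 1"
proof (induction n)
  case (Suc n)
  have "\<parallel>x [^] n \<otimes> x\<parallel> \<le> \<parallel>x [^] n\<parallel> * \<parallel>x\<parallel>" using assms by (intro nrm_mult) auto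
  also have "\<dots> \<le> 1" using Suc assms nrm_nonneg by (intro mult_le_one) auto
  finally show ?case by simp
qed (use nrm_one_le in simp)

lemma compression_contractive:
  assumes "x \<in> carrier A"
  shows "\<parallel>K [^] (m::nat) \<otimes> x \<otimes> R [^] (n::nat)\<parallel> \<le> \<parallel>x\<parallel>"
proof -
  have "\<parallel>K [^] m \<otimes> x \<otimes> R [^] n\<parallel> \<le> \<parallel>K [^] m \<otimes> x\<parallel> * \<parallel>R [^] n\<parallel>"
    using assms K R by (intro nrm_mult) auto
  also have "\<dots> \<le> \<parallel>K [^] m \<otimes> x\<parallel> * 1"
    using assms K R contraction_power nrm_nonneg by (intro mult_left_mono) auto
  also have "\<dots> \<le> \<parallel>K [^] m\<parallel> * \<parallel>x\<parallel>" using assms K nrm_mult by simp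
  also have "\<dots> \<le> 1 * \<parallel>x\<parallel>"
    using assms K contraction_power nrm_nonneg by (intro mult_right_mono) auto
  finally show ?thesis by simp
qed

lemma compression_minus:
  assumes "x \<in> carrier A" "y \<in> carrier A"
  shows "K [^] (m::nat) \<otimes> (x \<ominus> y) \<otimes> R [^] (n::nat) =
    K [^] m \<otimes> x \<otimes> R [^] n \<ominus> K [^] m \<otimes> y \<otimes> R [^] n"
  using assms K R by (simp add: a_minus_def l_distr r_distr l_minus r_minus)

lemma compression_eigenspace:
  assumes "y \<in> eigenspace K R r"
  shows "K [^] (m::nat) \<otimes> y \<otimes> R [^] (n::nat) \<in> eigenspace K R r"
proof -
  have "K [^] m \<otimes> y \<in> eigenspace K R r"
  proof (induction m)
    case 0 then show ?case using assms eigenspace_invariant(1) by auto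
  next
    case (Suc m)
    have "K [^] Suc m \<otimes> y = K \<otimes> (K [^] m \<otimes> y)"
      using assms K eigenspace_invariant(1) by (simp only: nat_pow_Suc2) (auto simp: m_assoc)
    then show ?case using Suc eigenspace_invariant(5) by simp
  qed
  then show ?thesis
  proof (induction n)
    case 0 then show ?case using eigenspace_invariant(1) by auto
  next
    case (Suc n)
    then have "K [^] m \<otimes> y \<otimes> R [^] n \<otimes> R \<in> eigenspace K R r" using eigenspace_invariant(6) by blast
    then show ?case using Suc(2) eigenspace_invariant(1) R by (auto simp: m_assoc subset_iff)
  qed
qed

text \<open>Once close to the eigenspace, always close: the eigenspace is invariant under multiplication by \<open>K\<close>
  on the left and by \<open>R\<close> on the right, and compressions are contractive.  Hence the exponents of two
  elements may be replaced by a common larger pair.\<close>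

lemma absorbed_mono:
  assumes x: "x \<in> carrier A" and y: "y \<in> eigenspace K R r" "\<parallel>K [^] m \<otimes> x \<otimes> R [^] n \<ominus> y\<parallel> < e"
    and le: "m \<le> m'" "n \<le> n'"
  shows "\<exists>y\<in> eigenspace K R r. \<parallel>K [^] (m'::nat) \<otimes> x \<otimes> R [^] (n'::nat) \<ominus> y\<parallel> < e"
proof
  let ?z = "K [^] m \<otimes> x \<otimes> R [^] n" and ?y = "K [^] (m' - m) \<otimes> y \<otimes> R [^] (n' - n)"
  have yc: "y \<in> carrier A" "?z \<in> carrier A" using x y eigenspace_invariant(1) K R by auto
  have "K [^] m' \<otimes> x \<otimes> R [^] n' = K [^] (m' - m) \<otimes> ?z \<otimes> R [^] (n' - n)"
    using compression_add[OF x, of m "m' - m" n "n' - n"] le by simp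
  then have "K [^] m' \<otimes> x \<otimes> R [^] n' \<ominus> ?y = K [^] (m' - m) \<otimes> (?z \<ominus> y) \<otimes> R [^] (n' - n)"
    using compression_minus yc by simp
  then have "\<parallel>K [^] m' \<otimes> x \<otimes> R [^] n' \<ominus> ?y\<parallel> \<le> \<parallel>?z \<ominus> y\<parallel>"
    using compression_contractive[of "?z \<ominus> y"] yc by simp
  then show "\<parallel>K [^] m' \<otimes> x \<otimes> R [^] n' \<ominus> ?y\<parallel> < e" using y(2) by linarith
  show "?y \<in> eigenspace K R r" by (rule compression_eigenspace[OF y(1)])
qed

lemma absorbedI:
  assumes "x \<in> carrier A" "\<And>e. e > 0 \<Longrightarrow> \<exists>m n. \<exists>y\<in> eigenspace K R r. \<parallel>K [^] (m::nat) \<otimes> x \<otimes> R [^] (n::nat) \<ominus> y\<parallel> < e"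
  shows "x \<in> absorbed K R r"
  using assms unfolding absorbed_def by blast

lemma absorbedE:
  assumes "x \<in> absorbed K R r" "e > 0"
  obtains m n y where "y \<in> eigenspace K R r" "y \<in> carrier A" "\<parallel>K [^] (m::nat) \<otimes> x \<otimes> R [^] (n::nat) \<ominus> y\<parallel> < e"
  using assms eigenspace_invariant(1) unfolding absorbed_def by blast

lemma absorbed_closed: "x \<in> absorbed K R r \<Longrightarrow> x \<in> carrier A"
  unfolding absorbed_def by blast

lemma eigenspace_absorbed:
  assumes y: "y \<in> eigenspace K R r"
  shows "y \<in> absorbed K R r"
proof (rule absorbedI)
  show "y \<in> carrier A" using y eigenspace_invariant(1) by blast
  then have "\<parallel>K [^] (0::nat) \<otimes> y \<otimes> R [^] (0::nat) \<ominus> y\<parallel> = 0" by (simp add: nrm_minus_self)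
  then show "\<exists>m n. \<exists>z\<in> eigenspace K R r. \<parallel>K [^] (m::nat) \<otimes> y \<otimes> R [^] (n::nat) \<ominus> z\<parallel> < e" if "e > 0" for e
    using y that by metis
qed

lemma closed_subspace_absorbed: "closed_subspace (absorbed K R r)"
proof (rule closed_subspaceI)
  show "absorbed K R r \<subseteq> carrier A" unfolding absorbed_def by blast
  show "\<zero> \<in> absorbed K R r" using eigenspace_absorbed eigenspace_invariant(2) by blast
  fix x assume x: "x \<in> absorbed K R r"
  note xc = absorbed_closed[OF x]
  show "x \<oplus> x' \<in> absorbed K R r" if x': "x' \<in> absorbed K R r" for x'
  proof (rule absorbedI)
    note x'c = absorbed_closed[OF x']
    show "x \<oplus> x' \<in> carrier A" using xc x'c by simp
    fix e :: real assume "e > 0"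
    then have e2: "e / 2 > 0" by simp
    obtain m n y where 1: "y \<in> eigenspace K R r" "\<parallel>K [^] (m::nat) \<otimes> x \<otimes> R [^] (n::nat) \<ominus> y\<parallel> < e/2"
      using absorbedE[OF x e2] by metis
    obtain m' n' y' where 2: "y' \<in> eigenspace K R r" "\<parallel>K [^] (m'::nat) \<otimes> x' \<otimes> R [^] (n'::nat) \<ominus> y'\<parallel> < e/2"
      using absorbedE[OF x' e2] by metis
    define M N where "M = max m m'" and "N = max n n'"
    obtain z where z: "z \<in> eigenspace K R r" "\<parallel>K [^] M \<otimes> x \<otimes> R [^] N \<ominus> z\<parallel> < e/2"
      using absorbed_mono[OF xc 1, of M N] unfolding M_def N_def by auto
    obtain z' where z': "z' \<in> eigenspace K R r" "\<parallel>K [^] M \<otimes> x' \<otimes> R [^] N \<ominus> z'\<parallel> < e/2"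
      using absorbed_mono[OF x'c 2, of M N] unfolding M_def N_def by auto
    have zc: "z \<in> carrier A" "z' \<in> carrier A" using z z' eigenspace_invariant(1) by auto
    have "K [^] M \<otimes> (x \<oplus> x') \<otimes> R [^] N = K [^] M \<otimes> x \<otimes> R [^] N \<oplus> K [^] M \<otimes> x' \<otimes> R [^] N"
      using xc x'c K R by (simp add: l_distr r_distr)
    then have "\<parallel>K [^] M \<otimes> (x \<oplus> x') \<otimes> R [^] N \<ominus> (z \<oplus> z')\<parallel> < e"
      using nrm_minus_add[of "K [^] M \<otimes> x \<otimes> R [^] N" "K [^] M \<otimes> x' \<otimes> R [^] N" z z'] z z' zc xc x'c K R
      by simp
    then show "\<exists>m n. \<exists>y\<in> eigenspace K R r. \<parallel>K [^] (m::nat) \<otimes> (x \<oplus> x') \<otimes> R [^] (n::nat) \<ominus> y\<parallel> < e"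
      using eigenspace_invariant(3) z z' by blast
  qed
  show "c \<odot> x \<in> absorbed K R r" for c
  proof (rule absorbedI)
    show "c \<odot> x \<in> carrier A" using xc by simp
    fix e :: real assume "e > 0"
    then have "e / (cmod c + 1) > 0" by (simp add: add_nonneg_pos)
    then obtain m n y where 1: "y \<in> eigenspace K R r" "y \<in> carrier A"
        "\<parallel>K [^] (m::nat) \<otimes> x \<otimes> R [^] (n::nat) \<ominus> y\<parallel> < e / (cmod c + 1)"
      using absorbedE[OF x] by metis
    have "\<parallel>K [^] m \<otimes> (c \<odot> x) \<otimes> R [^] n \<ominus> c \<odot> y\<parallel> \<le> cmod c * \<parallel>K [^] m \<otimes> x \<otimes> R [^] n \<ominus> y\<parallel>"
      using nrm_minus_smult[of "K [^] m \<otimes> x \<otimes> R [^] n" y c c] 1 xc K R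
      by (simp add: smult_mult_l smult_mult_r)
    also have "\<dots> \<le> (cmod c + 1) * \<parallel>K [^] m \<otimes> x \<otimes> R [^] n \<ominus> y\<parallel>"
      using xc 1 K R nrm_nonneg by (intro mult_right_mono) auto
    also have "\<dots> < e"
      using 1(3) by (simp add: pos_less_divide_eq add_nonneg_pos mult.commute)
    finally show "\<exists>m n. \<exists>y\<in> eigenspace K R r. \<parallel>K [^] (m::nat) \<otimes> (c \<odot> x) \<otimes> R [^] (n::nat) \<ominus> y\<parallel> < e"
      using eigenspace_invariant(4) 1 by blast
  qed
next
  fix \<sigma> l assume l: "l \<in> carrier A" "\<And>n. \<sigma> n \<in> absorbed K R r" "cstar_tendsto A \<sigma> l"
  show "l \<in> absorbed K R r"
  proof (rule absorbedI[OF l(1)])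
    fix e :: real assume "e > 0"
    then have e2: "e / 2 > 0" by simp
    obtain k where k: "\<parallel>\<sigma> k \<ominus> l\<parallel> < e/2" using cstar_tendsto_nearD[OF l(3) e2] by blast
    obtain m n y where 1: "y \<in> eigenspace K R r" "y \<in> carrier A" "\<parallel>K [^] (m::nat) \<otimes> \<sigma> k \<otimes> R [^] (n::nat) \<ominus> y\<parallel> < e/2"
      using absorbedE[OF l(2) e2] by metis
    have kc: "\<sigma> k \<in> carrier A" using absorbed_closed l by blast
    have "\<parallel>K [^] m \<otimes> l \<otimes> R [^] n \<ominus> K [^] m \<otimes> \<sigma> k \<otimes> R [^] n\<parallel> \<le> \<parallel>l \<ominus> \<sigma> k\<parallel>"
      using compression_contractive[of "l \<ominus> \<sigma> k" m n] compression_minus l(1) kc by simp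
    then have "\<parallel>K [^] m \<otimes> l \<otimes> R [^] n \<ominus> y\<parallel> < e"
      using nrm_minus_triangle[of "K [^] m \<otimes> l \<otimes> R [^] n" "K [^] m \<otimes> \<sigma> k \<otimes> R [^] n" y]
        nrm_minus_commute[of l "\<sigma> k"] k 1 l(1) kc K R by simp
    then show "\<exists>m n. \<exists>y\<in> eigenspace K R r. \<parallel>K [^] (m::nat) \<otimes> l \<otimes> R [^] (n::nat) \<ominus> y\<parallel> < e" using 1 by blast
  qed
qed

lemma absorbed_leftD:
  assumes x: "x \<in> carrier A" and Kx: "K \<otimes> x \<in> absorbed K R r"
  shows "x \<in> absorbed K R r"
proof (rule absorbedI[OF x])
  fix e :: real assume "e > 0"
  then obtain m n y where "y \<in> eigenspace K R r" "\<parallel>K [^] (m::nat) \<otimes> (K \<otimes> x) \<otimes> R [^] (n::nat) \<ominus> y\<parallel> < e"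
    using absorbedE[OF Kx] by metis
  moreover have "K [^] m \<otimes> (K \<otimes> x) = K [^] Suc m \<otimes> x" using x K by (simp add: m_assoc)
  ultimately show "\<exists>m n. \<exists>y\<in> eigenspace K R r. \<parallel>K [^] (m::nat) \<otimes> x \<otimes> R [^] (n::nat) \<ominus> y\<parallel> < e" by metis
qed

lemma absorbed_rightD:
  assumes x: "x \<in> carrier A" and xR: "x \<otimes> R \<in> absorbed K R r"
  shows "x \<in> absorbed K R r"
proof (rule absorbedI[OF x])
  fix e :: real assume "e > 0"
  then obtain m n y where "y \<in> eigenspace K R r" "\<parallel>K [^] (m::nat) \<otimes> (x \<otimes> R) \<otimes> R [^] (n::nat) \<ominus> y\<parallel> < e"
    using absorbedE[OF xR] by metis
  moreover have "K [^] m \<otimes> (x \<otimes> R) \<otimes> R [^] n = K [^] m \<otimes> x \<otimes> R [^] Suc n"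
    using x K R by (simp only: nat_pow_Suc2) (simp add: m_assoc)
  ultimately show "\<exists>m n. \<exists>y\<in> eigenspace K R r. \<parallel>K [^] (m::nat) \<otimes> x \<otimes> R [^] (n::nat) \<ominus> y\<parallel> < e" by metis
qed

lemma absorbed_compressD:
  assumes x: "x \<in> carrier A" and "K \<otimes> x \<otimes> R \<in> absorbed K R r"
  shows "x \<in> absorbed K R r"
  using absorbed_leftD[OF x absorbed_rightD] assms K by simp

lemma compression_eigenvector:
  assumes x: "x \<in> carrier A" and q: "K \<otimes> x \<otimes> R = q \<odot> x"
  shows "K [^] (n::nat) \<otimes> x \<otimes> R [^] n = q ^ n \<odot> x"
proof (induction n)
  case (Suc n)
  have "K [^] (n + 1) \<otimes> x \<otimes> R [^] (n + 1) = q ^ n \<odot> (q \<odot> x)"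
    using compression_add[OF x, of n 1 n 1] Suc K R x q
    by (simp add: smult_mult_l smult_mult_r smult_assoc[symmetric] mult.commute)
  then show ?case using x by (simp add: smult_assoc[symmetric] mult.commute)
qed (use x in \<open>simp add: smult_one\<close>)

lemma contracted_eigenvector_absorbed:
  assumes x: "x \<in> carrier A" and q: "K \<otimes> x \<otimes> R = q \<odot> x" "cmod q < 1"
  shows "x \<in> absorbed K R r"
proof (rule absorbedI[OF x])
  fix e :: real assume e: "e > 0"
  have "(\<lambda>n. cmod q ^ n * \<parallel>x\<parallel>) \<longlonglongrightarrow> 0 * \<parallel>x\<parallel>"
    using q(2) by (intro tendsto_mult LIMSEQ_power_zero tendsto_const) simp
  then have "\<forall>\<^sub>F n in sequentially. cmod q ^ n * \<parallel>x\<parallel> < e"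
    using e by (intro order_tendstoD(2)) auto
  then obtain n where "cmod q ^ n * \<parallel>x\<parallel> < e" unfolding eventually_sequentially by blast
  then have "\<parallel>K [^] n \<otimes> x \<otimes> R [^] n \<ominus> \<zero>\<parallel> < e"
    using compression_eigenvector[OF x q(1)] x by (simp add: nrm_smult norm_power)
  then show "\<exists>m n. \<exists>y\<in> eigenspace K R r. \<parallel>K [^] (m::nat) \<otimes> x \<otimes> R [^] (n::nat) \<ominus> y\<parallel> < e" using eigenspace_invariant(2) by blast
qed

end

text \<open>If \<open>W\<close> is fixed by the compression and close to \<open>z\<close> in the \<open>r\<close>-eigenspace, one more compression
  shows that \<open>W\<close> is as close to \<open>r z\<close>.  So \<open>W\<close> and \<open>r W\<close> are close, which forces \<open>W = 0\<close> for \<open>r \<noteq> 1\<close>.\<close>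

lemma absorbed_fixed_point_eq_zero:
  assumes K: "K \<in> carrier A" "\<parallel>K\<parallel> \<le> 1" and R: "R \<in> carrier A" "\<parallel>R\<parallel> \<le> 1"
    and W: "W \<in> absorbed K R r"
    and fixp: "K \<otimes> W \<otimes> R = W" and r: "r \<noteq> 1"
  shows "W = \<zero>"
proof -
  have Wc: "W \<in> carrier A" using W unfolding absorbed_def by blast
  have "\<parallel>W\<parallel> = 0"
  proof (rule ccontr)
    assume "\<parallel>W\<parallel> \<noteq> 0"
    then have "0 < \<parallel>W\<parallel>" using nrm_nonneg[OF Wc] by simp
    moreover define e where "e = cmod (1 - r) * \<parallel>W\<parallel> / (1 + cmod r)"
    \<comment> \<open>With this choice of \<open>e\<close> the final estimate reads \<open>\<bar>1 - r\<bar> \<parallel>W\<parallel> < \<bar>1 - r\<bar> \<parallel>W\<parallel>\<close>.\<close>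
    ultimately have "e > 0" using r by (simp add: divide_pos_pos add_pos_nonneg)
    then obtain m n y where ymn: "y \<in> eigenspace K R r" "\<parallel>K [^] (m::nat) \<otimes> W \<otimes> R [^] (n::nat) \<ominus> y\<parallel> < e"
      using W unfolding absorbed_def by blast
    then obtain z where z: "z \<in> eigenspace K R r" "\<parallel>K [^] max m n \<otimes> W \<otimes> R [^] max m n \<ominus> z\<parallel> < e"
      using absorbed_mono[OF K R Wc ymn, of "max m n" "max m n"] by auto
    have "K [^] max m n \<otimes> W \<otimes> R [^] max m n = 1 ^ max m n \<odot> W"
      by (rule compression_eigenvector[OF K R Wc]) (use fixp Wc in \<open>simp_all add: smult_one\<close>)
    then have near: "\<parallel>W \<ominus> z\<parallel> < e" using z Wc by (simp add: smult_one)
    have zc: "z \<in> carrier A" "K \<otimes> z \<otimes> R = r \<odot> z" using z by (auto simp: eigenspace_def)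
    have "K \<otimes> (W \<ominus> z) \<otimes> R = W \<ominus> r \<odot> z"
      using compression_minus[OF K R Wc zc(1), of 1 1] K R zc fixp by simp
    then have near': "\<parallel>W \<ominus> r \<odot> z\<parallel> \<le> \<parallel>W \<ominus> z\<parallel>"
      using compression_contractive[OF K R, of "W \<ominus> z" 1 1] K R zc Wc by simp
    have "(1 - r) \<odot> W = W \<ominus> r \<odot> W"
      using Wc smult_l_distr[OF Wc, of 1 "-r"] a_inv_smult[of "r \<odot> W"]
      by (simp add: a_minus_def smult_one smult_assoc[symmetric])
    then have "cmod (1 - r) * \<parallel>W\<parallel> = \<parallel>W \<ominus> r \<odot> W\<parallel>" using nrm_smult[OF Wc, of "1 - r"] by simp
    also have "\<dots> \<le> \<parallel>W \<ominus> r \<odot> z\<parallel> + \<parallel>r \<odot> z \<ominus> r \<odot> W\<parallel>"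
      using nrm_minus_triangle Wc zc by simp
    also have "\<parallel>r \<odot> z \<ominus> r \<odot> W\<parallel> \<le> cmod r * \<parallel>W \<ominus> z\<parallel>"
      using nrm_minus_smult[of z W r r] nrm_minus_commute[of W z] Wc zc by simp
    finally have "cmod (1 - r) * \<parallel>W\<parallel> \<le> (1 + cmod r) * \<parallel>W \<ominus> z\<parallel>"
      using near' by (simp add: algebra_simps)
    also have "\<dots> < (1 + cmod r) * e"
      using near by (intro mult_strict_left_mono) (auto simp: add_pos_nonneg)
    also have "\<dots> = cmod (1 - r) * \<parallel>W\<parallel>"
      using add_pos_nonneg[OF zero_less_one norm_ge_zero[of r]] by (simp add: e_def)
    finally show False by simp
  qed
  then show ?thesis using nrm_eq_0[OF Wc] by simp
qed

end

section \<open>Words in the generators of the 2-adic relations\<close>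

locale two_adic = cstar_algebra A for A (structure) +
  fixes U S :: 'a
  assumes relations: "two_adic_relations A U S"
begin

\<comment> \<open>This rule turns \<open>x [^] nat i\<close> into an integer power, which is defined by the group inverse
  instead of the adjoint.\<close>
declare pow_nat [simp del]

lemma U_closed [simp]: "U \<in> carrier A" and S_closed [simp]: "S \<in> carrier A"
  and adjU_U: "U\<^sup>\<star> \<otimes> U = \<one>" and U_adjU: "U \<otimes> U\<^sup>\<star> = \<one>" and adjS_S: "S\<^sup>\<star> \<otimes> S = \<one>"
  and S_U: "S \<otimes> U = U \<otimes> U \<otimes> S"
  and range_sum: "S \<otimes> S\<^sup>\<star> \<oplus> U \<otimes> S \<otimes> S\<^sup>\<star> \<otimes> U\<^sup>\<star> = \<one>"
  using relations unfolding two_adic_relations_def by (simp_all add: numeral_2_eq_2)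

lemma cancel_left [simp]:
  assumes "x \<in> carrier A"
  shows "U\<^sup>\<star> \<otimes> (U \<otimes> x) = x" "U \<otimes> (U\<^sup>\<star> \<otimes> x) = x" "S\<^sup>\<star> \<otimes> (S \<otimes> x) = x"
  using assms by (simp_all add: m_assoc[symmetric] adjU_U U_adjU adjS_S)

definition upow :: "int \<Rightarrow> 'a" where
  "upow i = (if 0 \<le> i then U [^] nat i else U\<^sup>\<star> [^] nat (- i))"

lemma upow_closed [simp]: "upow i \<in> carrier A"
  by (simp add: upow_def)

lemma upow_0 [simp]: "upow 0 = \<one>" and upow_1: "upow 1 = U"
  by (simp_all add: upow_def)

lemma U_upow: "U \<otimes> upow i = upow (i + 1)"
proof (cases "0 \<le> i")
  case True
  then have "nat (i + 1) = Suc (nat i)" by simp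
  then have "upow (i + 1) = U \<otimes> U [^] nat i"
    using True nat_pow_Suc2[of U] unfolding upow_def by simp
  then show ?thesis using True by (simp add: upow_def)
next
  case False
  then have "nat (- i) = Suc (nat (- (i + 1)))" by simp
  then have "upow i = U\<^sup>\<star> \<otimes> U\<^sup>\<star> [^] nat (- (i + 1))"
    using False nat_pow_Suc2[of "U\<^sup>\<star>"] unfolding upow_def by simp
  then have "U \<otimes> upow i = U\<^sup>\<star> [^] nat (- (i + 1))" by simp
  then show ?thesis using False by (cases "i = -1") (auto simp: upow_def)
qed

lemma adjU_upow: "U\<^sup>\<star> \<otimes> upow i = upow (i - 1)"
  using cancel_left(1)[of "upow (i - 1)"] U_upow[of "i - 1"] by simp

lemma upow_add: "upow i \<otimes> upow j = upow (i + j)"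
proof (induction i rule: int_induct[where k = 0])
  case (step1 i)
  have "upow (i + 1) \<otimes> upow j = U \<otimes> (upow i \<otimes> upow j)" by (simp add: U_upow[symmetric] m_assoc)
  then show ?case using step1 by (simp add: U_upow algebra_simps)
next
  case (step2 i)
  have "upow (i - 1) \<otimes> upow j = U\<^sup>\<star> \<otimes> (upow i \<otimes> upow j)"
    by (simp add: adjU_upow[symmetric] m_assoc)
  then show ?case using step2 by (simp add: adjU_upow algebra_simps)
qed simp

lemma adjU_eq: "U\<^sup>\<star> = upow (-1)"
  using adjU_upow[of 0] by simp

lemma adj_upow: "(upow i)\<^sup>\<star> = upow (- i)"
proof (induction i rule: int_induct[where k = 0])
  case (step1 i)
  have "(upow (i + 1))\<^sup>\<star> = (upow i)\<^sup>\<star> \<otimes> U\<^sup>\<star>" by (simp add: U_upow[symmetric] adj_mult)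
  then show ?case using step1 by (simp add: adjU_eq upow_add)
next
  case (step2 i)
  have "(upow (i - 1))\<^sup>\<star> = (upow i)\<^sup>\<star> \<otimes> upow 1" by (simp add: adjU_upow[symmetric] adj_mult upow_1)
  then show ?case using step2 by (simp add: upow_add)
qed simp

lemma S_upow: "S \<otimes> upow i = upow (2 * i) \<otimes> S"
proof (induction i rule: int_induct[where k = 0])
  case (step1 i)
  have "S \<otimes> upow (i + 1) = (S \<otimes> U) \<otimes> upow i" by (simp add: U_upow[symmetric] m_assoc)
  also have "\<dots> = U \<otimes> (U \<otimes> (S \<otimes> upow i))" by (simp add: S_U m_assoc)
  also have "\<dots> = U \<otimes> (U \<otimes> upow (2 * i)) \<otimes> S" using step1 by (simp add: m_assoc)
  finally show ?case by (simp add: U_upow algebra_simps)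
next
  case (step2 i)
  have "upow (2 * i) \<otimes> S = S \<otimes> upow i" using step2 by simp
  also have "\<dots> = (S \<otimes> U) \<otimes> upow (i - 1)" using U_upow[of "i - 1"] by (simp add: m_assoc)
  also have "\<dots> = upow 2 \<otimes> (S \<otimes> upow (i - 1))"
    using U_upow[of 1] by (simp add: S_U upow_1 m_assoc[symmetric])
  finally have "upow (-2) \<otimes> (upow (2 * i) \<otimes> S) = upow (-2) \<otimes> (upow 2 \<otimes> (S \<otimes> upow (i - 1)))"
    by simp
  then show ?case by (simp add: m_assoc[symmetric] upow_add algebra_simps)
qed simp

lemma adjS_upow: "S\<^sup>\<star> \<otimes> upow (2 * i) = upow i \<otimes> S\<^sup>\<star>"
  using arg_cong[OF S_upow[of "- i"], of "adj A"] by (simp add: adj_mult adj_upow)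

lemma adjS_pow_upow: "S\<^sup>\<star> [^] (n::nat) \<otimes> upow (2 ^ n * i) = upow i \<otimes> S\<^sup>\<star> [^] n"
proof (induction n arbitrary: i)
  case (Suc n)
  have "S\<^sup>\<star> [^] Suc n \<otimes> upow (2 ^ Suc n * i) = S\<^sup>\<star> [^] n \<otimes> (S\<^sup>\<star> \<otimes> upow (2 * (2 ^ n * i)))"
    by (simp add: m_assoc mult.assoc)
  also have "\<dots> = (S\<^sup>\<star> [^] n \<otimes> upow (2 ^ n * i)) \<otimes> S\<^sup>\<star>" by (simp only: adjS_upow) (simp add: m_assoc)
  finally show ?case using Suc by (simp add: m_assoc)
qed simp

text \<open>The ranges of \<open>S\<close> and \<open>U S\<close> are orthogonal: compressing \<open>S S\<^sup>\<star> + U S S\<^sup>\<star> U\<^sup>\<star> = 1\<close> by \<open>S\<close> gives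
  \<open>1 + x x\<^sup>\<star> = 1\<close> for \<open>x = S\<^sup>\<star> U S\<close>.\<close>

lemma adjS_U_S: "S\<^sup>\<star> \<otimes> U \<otimes> S = \<zero>"
proof -
  define x where "x = S\<^sup>\<star> \<otimes> U \<otimes> S"
  have x: "x \<in> carrier A" "x\<^sup>\<star> = S\<^sup>\<star> \<otimes> U\<^sup>\<star> \<otimes> S" by (simp_all add: x_def adj_mult m_assoc)
  have "\<one> = S\<^sup>\<star> \<otimes> (S \<otimes> S\<^sup>\<star> \<oplus> U \<otimes> S \<otimes> S\<^sup>\<star> \<otimes> U\<^sup>\<star>) \<otimes> S"
    using adjS_S by (simp add: range_sum)
  also have "\<dots> = \<one> \<oplus> x \<otimes> x\<^sup>\<star>"
    by (simp only: x(2)) (simp add: x_def l_distr r_distr m_assoc adjS_S)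
  finally have "x \<otimes> x\<^sup>\<star> = \<zero>" using x(1) by (metis add.l_cancel_one' adj_closed m_closed one_closed)
  then have "\<parallel>x\<^sup>\<star>\<parallel>\<^sup>2 = 0" using cstar_identity[of "x\<^sup>\<star>"] x(1) by simp
  then show ?thesis using nrm_adj nrm_eq_0 x(1) unfolding x_def[symmetric] by simp
qed

lemma adjS_upow_S_even: "S\<^sup>\<star> \<otimes> upow (2 * k) \<otimes> S = upow k"
  by (simp add: adjS_upow m_assoc adjS_S)

lemma adjS_upow_S_odd: "S\<^sup>\<star> \<otimes> upow (2 * k + 1) \<otimes> S = \<zero>"
proof -
  have "S\<^sup>\<star> \<otimes> upow (2 * k + 1) \<otimes> S = (S\<^sup>\<star> \<otimes> upow (2 * k)) \<otimes> (U \<otimes> S)"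
    by (simp add: upow_add[of "2 * k" 1, symmetric] upow_1 m_assoc)
  also have "\<dots> = upow k \<otimes> (S\<^sup>\<star> \<otimes> U \<otimes> S)" by (simp add: adjS_upow m_assoc)
  finally show ?thesis by (simp add: adjS_U_S)
qed

text \<open>The linear combinations \<open>x S\<^sub>1 + y S\<^sub>2\<close> of the Cuntz isometries \<open>S\<^sub>1 = U S\<close> and \<open>S\<^sub>2 = S\<close>.\<close>

definition comb :: "complex \<Rightarrow> complex \<Rightarrow> 'a" where
  "comb x y = x \<odot> (U \<otimes> S) \<oplus> y \<odot> S"

lemma comb_closed [simp]: "comb x y \<in> carrier A"
  by (simp add: comb_def)

lemma S_eq_comb: "S = comb 0 1"
  by (simp add: comb_def smult_zero_left smult_one)

lemma adj_comb_upow_comb: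
  "(comb b d)\<^sup>\<star> \<otimes> upow i \<otimes> comb a c =
    (cnj b * a + cnj d * c) \<odot> (S\<^sup>\<star> \<otimes> upow i \<otimes> S) \<oplus>
    ((cnj b * c) \<odot> (S\<^sup>\<star> \<otimes> upow (i - 1) \<otimes> S) \<oplus> (cnj d * a) \<odot> (S\<^sup>\<star> \<otimes> upow (i + 1) \<otimes> S))"
proof -
  have l: "(U \<otimes> S)\<^sup>\<star> \<otimes> upow j = S\<^sup>\<star> \<otimes> upow (j - 1)" for j
    by (simp add: adj_mult m_assoc adjU_upow)
  have r: "upow j \<otimes> (U \<otimes> S) = upow (j + 1) \<otimes> S" for j
    using upow_add[of j 1] by (simp add: upow_1 m_assoc[symmetric])
  show ?thesis
    by (simp add: comb_def adj_add adj_smult l_distr r_distr smult_mult_l smult_mult_r l r m_assoc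
        smult_assoc[symmetric] smult_l_distr smult_r_distr)
      (simp add: a_ac mult.commute)
qed

text \<open>Compression between two combinations halves the exponent of a power of \<open>U\<close>, an odd exponent
  being rounded both down and up.\<close>

lemma adj_comb_upow_comb_even:
  "(comb b d)\<^sup>\<star> \<otimes> upow (2 * k) \<otimes> comb a c = (cnj b * a + cnj d * c) \<odot> upow k"
  using adjS_upow_S_odd[of k] adjS_upow_S_odd[of "k - 1"] adjS_upow_S_even[of k]
  by (simp add: adj_comb_upow_comb algebra_simps)

lemma adj_comb_upow_comb_odd:
  "(comb b d)\<^sup>\<star> \<otimes> upow (2 * k + 1) \<otimes> comb a c = (cnj b * c) \<odot> upow k \<oplus> (cnj d * a) \<odot> upow (k + 1)"
  using adjS_upow_S_odd[of k] adjS_upow_S_even[of k] adjS_upow_S_even[of "k + 1"]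
  by (simp add: adj_comb_upow_comb algebra_simps)

text \<open>A subset of the *-monoid generated by \<open>U\<close> and \<open>S\<close>, together with 0, that contains 1 and is stable
  under left multiplication by the generators and their adjoints; so its closed span is everything
  that \<open>U\<close> and \<open>S\<close> generate.\<close>

definition words :: "'a set" where
  "words = insert \<zero> {upow i \<otimes> S [^] m \<otimes> S\<^sup>\<star> [^] n \<otimes> upow j | i j (m::nat) (n::nat). True}"

lemma wordsI: "upow i \<otimes> S [^] (m::nat) \<otimes> S\<^sup>\<star> [^] (n::nat) \<otimes> upow j \<in> words"
  unfolding words_def by blast

lemma adjS_word: "S\<^sup>\<star> \<otimes> (upow i \<otimes> S [^] (m::nat) \<otimes> S\<^sup>\<star> [^] (n::nat) \<otimes> upow j) \<in> words"
proof (cases m)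
  case 0
  have shift: "upow i \<otimes> S\<^sup>\<star> [^] k = S\<^sup>\<star> [^] k \<otimes> upow (2 ^ k * i)" for k :: nat
    by (simp add: adjS_pow_upow)
  have "S\<^sup>\<star> \<otimes> (upow i \<otimes> S\<^sup>\<star> [^] n \<otimes> upow j) = S\<^sup>\<star> [^] Suc n \<otimes> (upow (2 ^ n * i) \<otimes> upow j)"
    by (simp only: shift nat_pow_Suc2[OF adj_closed[OF S_closed]]) (simp add: m_assoc)
  then show ?thesis using 0 wordsI[of 0 0 "Suc n" "2 ^ n * i + j"] by (simp add: upow_add)
next
  case (Suc m')
  have eq: "S\<^sup>\<star> \<otimes> (upow i \<otimes> S [^] m \<otimes> S\<^sup>\<star> [^] n \<otimes> upow j) =
      (S\<^sup>\<star> \<otimes> upow i \<otimes> S) \<otimes> (S [^] m' \<otimes> S\<^sup>\<star> [^] n \<otimes> upow j)"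
    by (simp only: Suc nat_pow_Suc2[OF S_closed]) (simp add: m_assoc)
  show ?thesis
  proof (cases "even i")
    case True
    then obtain k where "i = 2 * k" by blast
    then show ?thesis using eq wordsI[of k m' n j] by (simp add: adjS_upow_S_even m_assoc)
  next
    case False
    then obtain k where "i = 2 * k + 1" by (rule oddE)
    then show ?thesis using eq by (simp add: adjS_upow_S_odd words_def)
  qed
qed

lemma words_left_invariant:
  assumes "g \<in> {U, S}" "v \<in> words"
  shows "g \<otimes> v \<in> words \<and> g\<^sup>\<star> \<otimes> v \<in> words"
proof (cases "v = \<zero>")
  case True then show ?thesis using assms(1) by (auto simp: words_def)
next
  case False
  then obtain i j m n where v: "v = upow i \<otimes> S [^] (m::nat) \<otimes> S\<^sup>\<star> [^] (n::nat) \<otimes> upow j"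
    using assms(2) unfolding words_def by blast
  have "U \<otimes> v \<in> words" "U\<^sup>\<star> \<otimes> v \<in> words"
    using wordsI[of "i + 1" m n j] wordsI[of "i - 1" m n j]
    by (simp_all add: v m_assoc flip: U_upow adjU_upow)
  moreover have "S \<otimes> v = upow (2 * i) \<otimes> S [^] Suc m \<otimes> S\<^sup>\<star> [^] n \<otimes> upow j"
    by (simp only: v nat_pow_Suc2[OF S_closed])
      (simp add: m_assoc[symmetric] S_upow[symmetric])
  moreover have "S\<^sup>\<star> \<otimes> v \<in> words" unfolding v by (rule adjS_word)
  ultimately show ?thesis using assms(1) wordsI[of "2 * i" "Suc m" n j] by auto
qed

section \<open>Compression between two combinations of the isometries\<close>

lemma adj_comb_upow_S:
  obtains e k where "(comb b d)\<^sup>\<star> \<otimes> upow i \<otimes> S = e \<odot> upow k"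
proof (cases "even i")
  case True
  then obtain k where "i = 2 * k" by blast
  then show ?thesis using that adj_comb_upow_comb_even[of b d k 0 1] S_eq_comb by metis
next
  case False
  then obtain k where "i = 2 * k + 1" by (rule oddE)
  then show ?thesis
    using that[of "cnj b" k] adj_comb_upow_comb_odd[of b d k 0 1]
    by (simp add: smult_zero_left flip: S_eq_comb)
qed

lemma adjS_upow_comb:
  obtains e k where "S\<^sup>\<star> \<otimes> upow i \<otimes> comb a c = e \<odot> upow k"
proof (cases "even i")
  case True
  then obtain k where "i = 2 * k" by blast
  then show ?thesis using that adj_comb_upow_comb_even[of 0 1 k a c] S_eq_comb by metis
next
  case False
  then obtain k where "i = 2 * k + 1" by (rule oddE)
  then show ?thesis
    using that[of "a" "k + 1"] adj_comb_upow_comb_odd[of 0 1 k a c]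
    by (simp add: smult_zero_left flip: S_eq_comb)
qed

text \<open>Here \<open>L = b S\<^sub>1 + d S\<^sub>2\<close>, \<open>R = a S\<^sub>1 + c S\<^sub>2\<close>, and \<open>\<Phi>(x) = L\<^sup>\<star> x R\<close>.  Iterating \<open>\<Phi>\<close> halves exponents of \<open>U\<close>
  until only 1, \<open>U\<close> and \<open>U\<^sup>\<star>\<close> are left; \<open>\<Phi>(1) = 0\<close>, and modulo multiples of 1 the other two are eigenvectors
  for the eigenvalues \<open>q = cnj d * a\<close> and \<open>p = cnj b * c\<close>.  If each of these has modulus less than 1 or
  equals \<open>r\<close>, then every power of \<open>U\<close> is absorbed by the \<open>r\<close>-eigenspace; a word in the generators
  becomes a multiple of a power of \<open>U\<close> after finitely many multiplications by \<open>L\<^sup>\<star>\<close> and \<open>R\<close>.  Hence the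
  whole algebra is absorbed, and no fixed point \<open>W \<noteq> 0\<close> remains when \<open>r \<noteq> 1\<close>.\<close>

lemma compression_fixed_point_eq_zero:
  assumes gen: "cstar_generated A {U, S} = carrier A"
    and L: "(comb b d)\<^sup>\<star> \<otimes> comb b d = \<one>" and R: "(comb a c)\<^sup>\<star> \<otimes> comb a c = \<one>"
    and orth: "(comb b d)\<^sup>\<star> \<otimes> comb a c = \<zero>"
    and W: "W \<in> carrier A" "(comb b d)\<^sup>\<star> \<otimes> W \<otimes> comb a c = W"
    and r: "r \<noteq> 1" "cmod (cnj b * c) < 1 \<or> cnj b * c = r" "cmod (cnj d * a) < 1 \<or> cnj d * a = r"
  shows "W = \<zero>"
proof -
  define K R where "K = (comb b d)\<^sup>\<star>" and "R = comb a c"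
  let ?N = "absorbed K R r"
  have Kc: "K \<in> carrier A" "\<parallel>K\<parallel> \<le> 1"
    using nrm_isometry_le[OF _ L] nrm_adj[of "comb b d"] by (simp_all add: K_def)
  have Rc: "R \<in> carrier A" "\<parallel>R\<parallel> \<le> 1"
    using nrm_isometry_le[OF _ R] by (simp_all add: R_def)
  note N = closed_subspaceD[OF closed_subspace_absorbed[OF Kc Rc]]
  note leftD = absorbed_leftD[OF Kc Rc]
    and rightD = absorbed_rightD[OF Kc Rc]
    and compressD = absorbed_compressD[OF Kc Rc]
  have killed: "y \<in> ?N" if "y \<in> carrier A" "K \<otimes> y \<otimes> R = \<zero>" for y
    using compressD[OF that(1)] that(2) N(2) by simp
  \<comment> \<open>\<open>x\<close> is an eigenvector modulo \<open>y\<close>, and \<open>y\<close> is killed by one compression.  For \<open>t \<noteq> 0\<close> the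
    correction of \<open>x\<close> by \<open>(s / t) y\<close> is an honest eigenvector.\<close>
  have triangular: "x \<in> ?N"
    if x: "x \<in> carrier A" and y: "y \<in> carrier A" "K \<otimes> y \<otimes> R = \<zero>"
      and eq: "K \<otimes> x \<otimes> R = s \<odot> y \<oplus> t \<odot> x" and t: "cmod t < 1 \<or> t = r" for x y s t
  proof (cases "t = 0")
    case True
    then show ?thesis using compressD[OF x] eq N(4)[OF killed[OF y]] x y by (simp add: smult_zero_left)
  next
    case False
    define e where "e = x \<oplus> (s / t) \<odot> y"
    have e: "e \<in> carrier A" using x y by (simp add: e_def)
    have "K \<otimes> e \<otimes> R = K \<otimes> x \<otimes> R \<oplus> (s / t) \<odot> (K \<otimes> y \<otimes> R)"
      using x y(1) Kc Rc by (simp add: e_def l_distr r_distr smult_mult_l smult_mult_r)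
    also have "\<dots> = t \<odot> e"
      using x y False by (simp add: eq e_def smult_r_distr smult_assoc[symmetric] a_comm)
    finally have eig: "K \<otimes> e \<otimes> R = t \<odot> e" .
    have "e \<in> ?N"
      using t contracted_eigenvector_absorbed[OF Kc Rc e eig] eigenspace_absorbed[OF Kc Rc, of e] e eig
      by (auto simp: eigenspace_def)
    moreover have "x = e \<oplus> (- (s / t)) \<odot> y"
      using x y smult_l_distr[OF y(1), of "s / t" "- (s / t)"] smult_zero_left[OF y(1)]
      by (simp add: e_def a_assoc)
    ultimately show ?thesis using N(3) N(4)[OF killed[OF y]] by simp
  qed
  have one: "K \<otimes> \<one> \<otimes> R = \<zero>" using orth by (simp add: K_def R_def)
  have even: "K \<otimes> upow (2 * k) \<otimes> R = \<zero>" for k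
  proof -
    have "K \<otimes> upow (2 * k) \<otimes> R = (K \<otimes> upow (2 * 0) \<otimes> R) \<otimes> upow k"
      unfolding K_def R_def adj_comb_upow_comb_even by (simp add: smult_mult_l)
    then show ?thesis using one by simp
  qed
  have odd: "K \<otimes> upow (2 * k + 1) \<otimes> R = (cnj b * c) \<odot> upow k \<oplus> (cnj d * a) \<odot> upow (k + 1)" for k
    unfolding K_def R_def by (rule adj_comb_upow_comb_odd)
  have upow: "upow i \<in> ?N" for i
  proof (induction "nat \<bar>i\<bar>" arbitrary: i rule: less_induct)
    case less
    show ?case
    proof (cases "even i")
      case True
      then obtain k where "i = 2 * k" by blast
      then show ?thesis using killed even by simp
    next
      case False
      then obtain k where k: "i = 2 * k + 1" by (rule oddE)
      \<comment> \<open>Rounding \<open>i / 2\<close> strictly lowers the absolute value except for \<open>i = 1\<close> and \<open>i = -1\<close>.\<close>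
      consider "k = 0" | "k = -1" | "nat \<bar>k\<bar> < nat \<bar>i\<bar>" "nat \<bar>k + 1\<bar> < nat \<bar>i\<bar>"
        using k by linarith
      then show ?thesis
      proof cases
        case 1
        then show ?thesis using triangular[OF _ _ one _ r(3)] odd[of 0] k by simp
      next
        case 2
        have "K \<otimes> upow (-1) \<otimes> R = (cnj d * a) \<odot> \<one> \<oplus> (cnj b * c) \<odot> upow (-1)"
          using odd[of "-1"] by (simp add: a_comm)
        then show ?thesis using triangular[OF _ _ one _ r(2)] k 2 by simp
      next
        case 3
        then show ?thesis using compressD[of "upow i"] odd[of k] less[of k] less[of "k + 1"] N(3,4) k
          by simp
      qed
    qed
  qed
  have right_word: "upow i \<otimes> S\<^sup>\<star> [^] (n::nat) \<otimes> upow j \<in> ?N" for i j n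
  proof (induction n arbitrary: j)
    case 0 then show ?case using upow by (simp add: upow_add)
  next
    case (Suc n)
    obtain e k where ek: "S\<^sup>\<star> \<otimes> upow j \<otimes> R = e \<odot> upow k"
      unfolding R_def by (rule adjS_upow_comb)
    have "upow i \<otimes> S\<^sup>\<star> [^] Suc n \<otimes> upow j \<otimes> R = upow i \<otimes> S\<^sup>\<star> [^] n \<otimes> (S\<^sup>\<star> \<otimes> upow j \<otimes> R)"
      using Rc by (simp add: m_assoc)
    also have "\<dots> = e \<odot> (upow i \<otimes> S\<^sup>\<star> [^] n \<otimes> upow k)" by (simp add: ek smult_mult_r)
    finally show ?case using rightD Suc N(4) by simp
  qed
  have word: "upow i \<otimes> S [^] (m::nat) \<otimes> S\<^sup>\<star> [^] (n::nat) \<otimes> upow j \<in> ?N" for i j m n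
  proof (induction m arbitrary: i)
    case 0 then show ?case using right_word by simp
  next
    case (Suc m)
    obtain e k where ek: "K \<otimes> upow i \<otimes> S = e \<odot> upow k"
      unfolding K_def by (rule adj_comb_upow_S)
    have "K \<otimes> (upow i \<otimes> S [^] Suc m \<otimes> S\<^sup>\<star> [^] n \<otimes> upow j) =
        (K \<otimes> upow i \<otimes> S) \<otimes> (S [^] m \<otimes> S\<^sup>\<star> [^] n \<otimes> upow j)"
      using Kc by (simp only: nat_pow_Suc2[OF S_closed]) (simp add: m_assoc)
    also have "\<dots> = e \<odot> (upow k \<otimes> S [^] m \<otimes> S\<^sup>\<star> [^] n \<otimes> upow j)"
      by (simp add: ek smult_mult_l m_assoc)
    finally show ?case using leftD Suc N(4) by simp
  qed
  have "words \<subseteq> ?N" using word N(2) unfolding words_def by blast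
  moreover have "words \<subseteq> carrier A" "\<one> \<in> words"
    using wordsI[of 0 0 0 0] by (auto simp: words_def)
  ultimately have "cstar_generated A {U, S} \<subseteq> ?N"
    using generated_subset_closed_subspace[of "{U, S}" words ?N] words_left_invariant
      closed_subspace_absorbed[OF Kc Rc] by auto
  then have "W \<in> ?N" using gen W(1) by blast
  then show ?thesis
    using absorbed_fixed_point_eq_zero[OF Kc Rc, of W r] W r(1) unfolding eigenspace_def K_def R_def by simp
qed

text \<open>From \<open>L W = W R\<close> follows \<open>L\<^sup>\<star> W R = W\<close>.  The moduli of \<open>p = cnj b * c\<close> and \<open>q = cnj d * a\<close> add up
  to 1, so at most one of them reaches 1.  If \<open>\<bar>p\<bar> < 1\<close>, the fixed point excludes \<open>r = q\<close> unless
  \<open>q = 1\<close>; if \<open>\<bar>p\<bar> = 1\<close>, then \<open>q = 0\<close> and \<open>r = p\<close> gives \<open>p = 1\<close>.\<close>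

lemma intertwined_comb_coefficients:
  assumes gen: "cstar_generated A {U, S} = carrier A" and nontriv: "\<one> \<noteq> \<zero>"
    and L: "(comb b d)\<^sup>\<star> \<otimes> comb b d = \<one>" and R: "(comb a c)\<^sup>\<star> \<otimes> comb a c = \<one>"
    and orth: "(comb b d)\<^sup>\<star> \<otimes> comb a c = \<zero>"
    and W: "W \<in> carrier A" "W\<^sup>\<star> \<otimes> W = \<one>" "comb b d \<otimes> W = W \<otimes> comb a c"
    and unitary: "(cmod a)\<^sup>2 + (cmod b)\<^sup>2 = 1" "(cmod a)\<^sup>2 + (cmod c)\<^sup>2 = 1" "(cmod b)\<^sup>2 + (cmod d)\<^sup>2 = 1"
  shows "(b = 0 \<and> c = 0 \<and> a = d \<and> cmod a = 1) \<or> (a = 0 \<and> d = 0 \<and> b = c \<and> cmod b = 1)"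
proof -
  let ?p = "cnj b * c" and ?q = "cnj d * a"
  have "(comb b d)\<^sup>\<star> \<otimes> W \<otimes> comb a c = (comb b d)\<^sup>\<star> \<otimes> (comb b d \<otimes> W)"
    using W(1) by (simp add: W(3) m_assoc)
  also have "\<dots> = W" using W(1) by (simp add: m_assoc[symmetric] L)
  finally have fixp: "(comb b d)\<^sup>\<star> \<otimes> W \<otimes> comb a c = W" .
  have "W \<noteq> \<zero>" using W(2) nontriv by auto
  then have key: "r = 1 \<or> \<not> (cmod ?p < 1 \<or> ?p = r) \<or> \<not> (cmod ?q < 1 \<or> ?q = r)" for r
    using compression_fixed_point_eq_zero[OF gen L R orth W(1) fixp] by blast
  have "(cmod d)\<^sup>2 = (cmod a)\<^sup>2" "(cmod c)\<^sup>2 = (cmod b)\<^sup>2" using unitary by linarith+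
  then have eq: "cmod d = cmod a" "cmod c = cmod b" by simp_all
  have cm: "cmod ?p = (cmod b)\<^sup>2" "cmod ?q = (cmod a)\<^sup>2"
    using eq by (simp_all add: norm_mult power2_eq_square)
  show ?thesis
  proof (cases "cmod ?p < 1")
    case True
    then have q: "?q = 1" using key[of ?q] by blast
    then have a1: "(cmod a)\<^sup>2 = 1" using cm by simp
    then have "b = 0" "c = 0" using unitary eq by simp_all
    have "a * cnj a = 1" using a1 by (simp add: complex_norm_square[symmetric])
    then have "a = d"
      using q by (metis complex_cnj_cancel_iff mult.commute mult_cancel_right mult_zero_left zero_neq_one)
    then show ?thesis using power2_eq_imp_eq[of "cmod a" 1] a1 \<open>b = 0\<close> \<open>c = 0\<close> by simp
  next
    case False
    then have b1: "(cmod b)\<^sup>2 = 1" using unitary(1) zero_le_power2[of "cmod a"] unfolding cm by linarith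
    then have "a = 0" "d = 0" using unitary eq by simp_all
    then have p: "?p = 1" using key[of ?p] by auto
    have "b * cnj b = 1" using b1 by (simp add: complex_norm_square[symmetric])
    then have "b = c"
      using p by (metis mult.commute mult_cancel_right mult_zero_left zero_neq_one)
    then show ?thesis using power2_eq_imp_eq[of "cmod b" 1] b1 \<open>a = 0\<close> \<open>d = 0\<close> by simp
  qed
qed

section \<open>The gauge action and the flip-flop\<close>

lemma rotated_relations:
  assumes "cmod z = 1"
  shows "two_adic_relations A U (z \<odot> S)"
proof -
  have z: "z * cnj z = 1" "cnj z * z = 1"
    using assms complex_norm_square[of z] by (simp_all add: mult.commute)
  show ?thesis
    using S_U adjS_S range_sum
    by (simp add: two_adic_relations_def numeral_2_eq_2 adjU_U U_adjU adj_smult smult_mult_l smult_mult_r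
        smult_assoc[symmetric] z smult_one)
qed

text \<open>Since \<open>U\<^sup>\<star> (U S) = S\<close>, a homomorphism that carries \<open>(U, S)\<close> to \<open>(U\<^sup>\<star>, U S)\<close>
  exchanges the two Cuntz isometries.\<close>

lemma flipped_relations: "two_adic_relations A (U\<^sup>\<star>) (U \<otimes> S)"
proof -
  have "U \<otimes> S \<otimes> U\<^sup>\<star> = U \<otimes> (upow (-2) \<otimes> S)"
    using S_upow[of "-1"] by (simp add: adjU_eq m_assoc)
  also have "\<dots> = U\<^sup>\<star> \<otimes> U\<^sup>\<star> \<otimes> (U \<otimes> S)"
    using U_upow[of "-2"] by (simp add: m_assoc[symmetric] adjU_eq[symmetric])
      (simp add: m_assoc adjU_U)
  finally have 1: "U \<otimes> S \<otimes> U\<^sup>\<star> = U\<^sup>\<star> \<otimes> U\<^sup>\<star> \<otimes> (U \<otimes> S)" .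
  have "(U \<otimes> S) \<otimes> (U \<otimes> S)\<^sup>\<star> \<oplus> U\<^sup>\<star> \<otimes> (U \<otimes> S) \<otimes> (U \<otimes> S)\<^sup>\<star> \<otimes> (U\<^sup>\<star>)\<^sup>\<star> =
      U \<otimes> S \<otimes> S\<^sup>\<star> \<otimes> U\<^sup>\<star> \<oplus> S \<otimes> S\<^sup>\<star>"
    by (simp add: adj_mult m_assoc adjU_U)
  also have "\<dots> = \<one>" using range_sum by (simp add: a_comm)
  finally show ?thesis
    using 1 by (simp add: two_adic_relations_def numeral_2_eq_2 adjU_U U_adjU) (simp add: adj_mult m_assoc adjS_S)
qed

end

section \<open>Extensions of automorphisms of the Cuntz algebra\<close>

lemma star_hom_restrict:
  assumes "f \<in> star_hom A B" "H \<subseteq> carrier A"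
  shows "f \<in> star_hom (A\<lparr>carrier := H\<rparr>) B"
  using assms unfolding star_hom_def ring_hom_def by (auto simp: subset_iff)

lemma star_hom_codomain:
  assumes "f \<in> star_hom A B" "f ` carrier A \<subseteq> K"
  shows "f \<in> star_hom A (B\<lparr>carrier := K\<rparr>)"
  using assms unfolding star_hom_def ring_hom_def by auto

lemma star_hom_codomainD:
  assumes "f \<in> star_hom A (B\<lparr>carrier := K\<rparr>)" "K \<subseteq> carrier B"
  shows "f \<in> star_hom A B"
  using assms unfolding star_hom_def ring_hom_def by auto

lemma star_hom_comp:
  assumes "cstar_algebra A" "f \<in> star_hom A B" "g \<in> star_hom B C"
  shows "(\<lambda>x. g (f x)) \<in> star_hom A C"
proof -
  interpret cstar_algebra A by fact
  show ?thesis using assms(2,3) unfolding star_hom_def ring_hom_def by (auto simp: Pi_iff)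
qed

lemma star_hom_id: "(\<lambda>x. x) \<in> star_hom A A"
  unfolding star_hom_def ring_hom_def by auto

lemma star_aut_comp:
  assumes "cstar_algebra A" "f \<in> star_aut A" "g \<in> star_aut A"
  shows "(\<lambda>x. g (f x)) \<in> star_aut A"
  using star_hom_comp[OF assms(1)] assms(2,3) bij_betw_trans[of f "carrier A" "carrier A" g "carrier A"]
  unfolding star_aut_def comp_def by blast

lemma unitary_matrix_2_norms:
  fixes M :: "complex ^ 2 ^ 2"
  assumes "unitary_matrix M"
  shows "(cmod (M $ 1 $ 1))\<^sup>2 + (cmod (M $ 1 $ 2))\<^sup>2 = 1"
    "(cmod (M $ 1 $ 1))\<^sup>2 + (cmod (M $ 2 $ 1))\<^sup>2 = 1"
    "(cmod (M $ 1 $ 2))\<^sup>2 + (cmod (M $ 2 $ 2))\<^sup>2 = 1"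
proof -
  have "M $ 1 $ 1 * cnj (M $ 1 $ 1) + M $ 1 $ 2 * cnj (M $ 1 $ 2) = 1"
    "cnj (M $ 1 $ 1) * M $ 1 $ 1 + cnj (M $ 2 $ 1) * M $ 2 $ 1 = 1"
    "cnj (M $ 1 $ 2) * M $ 1 $ 2 + cnj (M $ 2 $ 2) * M $ 2 $ 2 = 1"
    using assms
    by (simp_all add: unitary_matrix_def vec_eq_iff matrix_matrix_mult_def map_matrix_def
        transpose_def mat_def forall_2 sum_2)
  then have "complex_of_real ((cmod (M $ 1 $ 1))\<^sup>2 + (cmod (M $ 1 $ 2))\<^sup>2) = complex_of_real 1"
    "complex_of_real ((cmod (M $ 1 $ 1))\<^sup>2 + (cmod (M $ 2 $ 1))\<^sup>2) = complex_of_real 1"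
    "complex_of_real ((cmod (M $ 1 $ 2))\<^sup>2 + (cmod (M $ 2 $ 2))\<^sup>2) = complex_of_real 1"
    by (simp_all add: complex_norm_square mult.commute del: of_real_power)
  then show "(cmod (M $ 1 $ 1))\<^sup>2 + (cmod (M $ 1 $ 2))\<^sup>2 = 1"
    "(cmod (M $ 1 $ 1))\<^sup>2 + (cmod (M $ 2 $ 1))\<^sup>2 = 1"
    "(cmod (M $ 1 $ 2))\<^sup>2 + (cmod (M $ 2 $ 2))\<^sup>2 = 1"
    unfolding of_real_eq_iff by blast+
qed

text \<open>The parameters \<open>S1\<close> and \<open>\<O>\<close> are determined by the others; naming them gives the facts the
  notation in which extensions of automorphisms are stated.\<close>

locale two_adic_ring =
  fixes Q :: "'a cstar" (structure) and U S2 :: 'a and S1 :: 'a and \<O> :: "'a cstar"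
  assumes univ: "two_adic_ring_cstar Q U S2"
    and S1_def: "S1 = U \<otimes> S2"
    and \<O>_def: "\<O> = cuntz_O2 Q U S2"

sublocale two_adic_ring \<subseteq> two_adic Q U S2
  using univ unfolding two_adic_ring_cstar_def two_adic_def two_adic_axioms_def by blast

context two_adic_ring
begin

lemma gens_closed: "{S1, S2} \<subseteq> carrier Q"
  by (simp add: S1_def)

lemma \<O>_eq: "\<O> = Q\<lparr>carrier := cstar_generated Q {S1, S2}\<rparr>"
  by (simp add: \<O>_def cuntz_O2_def S1_def)

lemma carrier_\<O>: "carrier \<O> = cstar_generated Q {S1, S2}"
  by (simp add: \<O>_eq)

lemma \<O>_subalgebra: "cstar_subalgebra (carrier \<O>) Q" "S1 \<in> carrier \<O>" "S2 \<in> carrier \<O>"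
  using cstar_subalgebra_generated[OF gens_closed] by (simp_all add: carrier_\<O>)

lemma \<O>_subset: "carrier \<O> \<subseteq> carrier Q"
  using \<O>_subalgebra(1) unfolding cstar_subalgebra_def by blast

lemma cstar_\<O>: "cstar_algebra \<O>"
  unfolding \<O>_eq by (rule cstar_algebra_restrict) (use \<O>_subalgebra carrier_\<O> in simp)

lemma star_hom_\<O>:
  assumes "f \<in> star_hom Q Q"
  shows "f \<in> star_hom \<O> Q"
  using star_hom_restrict[OF assms \<O>_subset] by (simp add: \<O>_eq)

lemma star_hom_\<O>_Q:
  assumes "f \<in> star_hom \<O> \<O>"
  shows "f \<in> star_hom \<O> Q"
  by (rule star_hom_codomainD[where B = Q and K = "carrier \<O>"]) (use assms \<O>_subset in \<open>simp_all add: \<O>_eq\<close>)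

lemma star_hom_eq_on_\<O>:
  assumes "f \<in> star_hom \<O> Q" "g \<in> star_hom \<O> Q" "f S1 = g S1" "f S2 = g S2" "x \<in> carrier \<O>"
  shows "f x = g x"
  by (rule star_hom_eq_on_generated[OF cstar_algebra_axioms gens_closed])
    (use assms in \<open>auto simp: \<O>_eq\<close>)

lemma diagonal_extends:
  assumes \<alpha>: "\<alpha> \<in> star_aut \<O>" and z: "cmod z = 1"
    and "\<alpha> S1 = z \<odot> S1" "\<alpha> S2 = z \<odot> S2"
  shows "\<exists>\<Lambda>\<in>star_hom Q Q. \<forall>x\<in>carrier \<O>. \<Lambda> x = \<alpha> x"
proof -
  obtain \<Lambda> where \<Lambda>: "\<Lambda> \<in> star_hom Q Q" "\<Lambda> U = U" "\<Lambda> S2 = z \<odot> S2"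
    using two_adic_ring_universal[OF univ cstar_algebra_axioms rotated_relations[OF z]] by blast
  have "\<Lambda> S1 = z \<odot> S1"
    using \<Lambda>(2,3) star_homD(2)[OF \<Lambda>(1)] by (simp add: S1_def smult_mult_r)
  then show ?thesis
    using star_hom_eq_on_\<O>[OF star_hom_\<O>[OF \<Lambda>(1)] star_hom_\<O>_Q, of \<alpha>] assms \<Lambda>
    unfolding star_aut_def by (intro bexI[of _ \<Lambda>]) auto
qed

lemma antidiagonal_extends:
  assumes \<alpha>: "\<alpha> \<in> star_aut \<O>" and z: "cmod z = 1"
    and "\<alpha> S1 = z \<odot> S2" "\<alpha> S2 = z \<odot> S1"
  shows "\<exists>\<Lambda>\<in>star_hom Q Q. \<forall>x\<in>carrier \<O>. \<Lambda> x = \<alpha> x"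
proof -
  interpret flipped: two_adic Q "U\<^sup>\<star>" "U \<otimes> S2"
    by unfold_locales (rule flipped_relations)
  obtain \<Lambda> where \<Lambda>: "\<Lambda> \<in> star_hom Q Q" "\<Lambda> U = U\<^sup>\<star>" "\<Lambda> S2 = z \<odot> S1"
    using two_adic_ring_universal[OF univ cstar_algebra_axioms flipped.rotated_relations[OF z]]
    unfolding S1_def by blast
  have "\<Lambda> S1 = z \<odot> S2"
    using \<Lambda>(2,3) star_homD(2)[OF \<Lambda>(1)] by (simp add: S1_def smult_mult_r)
  then show ?thesis
    using star_hom_eq_on_\<O>[OF star_hom_\<O>[OF \<Lambda>(1)] star_hom_\<O>_Q, of \<alpha>] assms \<Lambda>
    unfolding star_aut_def by (intro bexI[of _ \<Lambda>]) auto
qed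

lemma flip_flop_exists:
  obtains \<phi> where "flip_flop \<O> S1 S2 \<phi>" "\<And>x. x \<in> carrier \<O> \<Longrightarrow> \<phi> (\<phi> x) = x"
proof -
  obtain \<phi> where \<phi>: "\<phi> \<in> star_hom Q Q" "\<phi> U = U\<^sup>\<star>" "\<phi> S2 = S1"
    using two_adic_ring_universal[OF univ cstar_algebra_axioms flipped_relations] S1_def by blast
  have \<phi>1: "\<phi> S1 = S2"
    using \<phi>(2,3) star_homD(2)[OF \<phi>(1)] by (simp add: S1_def)
  have maps: "\<phi> x \<in> carrier \<O>" if "x \<in> carrier \<O>" for x
    using star_hom_generated_image[OF cstar_algebra_axioms \<phi>(1) gens_closed \<O>_subalgebra(1)]
      \<phi> \<phi>1 \<O>_subalgebra that by (auto simp: carrier_\<O>)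
  have hom: "\<phi> \<in> star_hom \<O> \<O>"
    using star_hom_codomain[OF star_hom_\<O>[OF \<phi>(1)], of "carrier \<O>"] maps
    by (auto simp: \<O>_eq)
  have inv: "\<phi> (\<phi> x) = x" if x: "x \<in> carrier \<O>" for x
    using star_hom_eq_on_\<O>[OF star_hom_\<O>_Q[OF star_hom_comp[OF cstar_\<O> hom hom]]
        star_hom_\<O>_Q[OF star_hom_id] _ _ x] \<phi> \<phi>1 by simp
  have "bij_betw \<phi> (carrier \<O>) (carrier \<O>)"
    by (rule bij_betwI[where g = \<phi>]) (use maps inv in auto)
  then show ?thesis using that hom inv \<phi> \<phi>1 unfolding flip_flop_def star_aut_def by blast
qed

text \<open>The image \<open>W\<close> of \<open>U\<close> under an extension intertwines the images of the Cuntz isometries, since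
  \<open>S\<^sub>2 U = U\<^sup>2 S\<^sub>2 = U S\<^sub>1\<close>.\<close>

lemma extension_form:
  assumes \<alpha>: "\<alpha> \<in> star_aut \<O>" and M: "unitary_matrix (M :: complex ^ 2 ^ 2)"
    "\<alpha> S1 = (M $ 1 $ 1) \<odot> S1 \<oplus> (M $ 2 $ 1) \<odot> S2"
    "\<alpha> S2 = (M $ 1 $ 2) \<odot> S1 \<oplus> (M $ 2 $ 2) \<odot> S2"
    and \<Lambda>: "\<Lambda> \<in> star_hom Q Q" "\<And>x. x \<in> carrier \<O> \<Longrightarrow> \<Lambda> x = \<alpha> x" and nontriv: "\<one> \<noteq> \<zero>"
  obtains z where "cmod z = 1" "\<alpha> S1 = z \<odot> S1 \<and> \<alpha> S2 = z \<odot> S2 \<or> \<alpha> S1 = z \<odot> S2 \<and> \<alpha> S2 = z \<odot> S1"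
proof -
  let ?a = "M $ 1 $ 1" and ?b = "M $ 1 $ 2" and ?c = "M $ 2 $ 1" and ?d = "M $ 2 $ 2"
  note hom = star_homD[OF \<Lambda>(1)]
  have zero: "\<Lambda> \<zero> = \<zero>"
    using hom(5)[of \<zero> 0] smult_zero_left[of "\<Lambda> \<zero>"] hom(1)[of \<zero>] by simp
  have T1: "comb ?a ?c = \<Lambda> (U \<otimes> S2)" using \<Lambda>(2)[of S1] M \<O>_subalgebra by (simp add: comb_def S1_def)
  have T2: "comb ?b ?d = \<Lambda> S2" using \<Lambda>(2)[of S2] M \<O>_subalgebra by (simp add: comb_def S1_def)
  have "(?b = 0 \<and> ?c = 0 \<and> ?a = ?d \<and> cmod ?a = 1) \<or> (?a = 0 \<and> ?d = 0 \<and> ?b = ?c \<and> cmod ?b = 1)"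
  proof (rule intertwined_comb_coefficients[OF _ nontriv])
    show "cstar_generated Q {U, S2} = carrier Q" using univ unfolding two_adic_ring_cstar_def by blast
    show "(comb ?b ?d)\<^sup>\<star> \<otimes> comb ?b ?d = \<one>"
      unfolding T2 using hom(2)[of "S2\<^sup>\<star>" S2] by (simp add: hom(4,6) adjS_S)
    show "(comb ?a ?c)\<^sup>\<star> \<otimes> comb ?a ?c = \<one>"
      unfolding T1 using hom(2)[of "(U \<otimes> S2)\<^sup>\<star>" "U \<otimes> S2"] hom(6)[of "U \<otimes> S2"]
      by (simp add: hom(4) adj_mult m_assoc adjS_S)
    show "(comb ?b ?d)\<^sup>\<star> \<otimes> comb ?a ?c = \<zero>"
      unfolding T1 T2 using hom(2)[of "S2\<^sup>\<star>" "U \<otimes> S2"] adjS_U_S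
      by (simp add: hom(6) zero m_assoc)
    show "\<Lambda> U \<in> carrier Q" using hom(1) by simp
    show "(\<Lambda> U)\<^sup>\<star> \<otimes> \<Lambda> U = \<one>" using hom(2)[of "U\<^sup>\<star>" U] by (simp add: hom(4,6) adjU_U)
    show "comb ?b ?d \<otimes> \<Lambda> U = \<Lambda> U \<otimes> comb ?a ?c"
      unfolding T1 T2 using hom(2)[of S2 U] hom(2)[of U "U \<otimes> S2"] by (simp add: S_U m_assoc)
  qed (rule unitary_matrix_2_norms[OF M(1)])+
  then show ?thesis
    using that M gens_closed by (fastforce simp: smult_zero_left)
qed

end

theorem theorem4p14:
  fixes Q :: "'a cstar" and U S1 S2 :: 'a and \<O> :: "'a cstar" and \<alpha> :: "'a \<Rightarrow> 'a"
  assumes "two_adic_ring_cstar Q U S2"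
    and "S1 = U \<otimes>\<^bsub>Q\<^esub> S2"
    and "\<O> = cuntz_O2 Q U S2"
    and "bogoljubov \<O> S1 S2 \<alpha>"
  shows "(\<exists>\<Lambda>\<in>star_hom Q Q. \<forall>x\<in>carrier \<O>. \<Lambda> x = \<alpha> x) \<longleftrightarrow>
    flip_flop \<O> S1 S2 \<alpha> \<or> gauge_aut \<O> S1 S2 \<alpha> \<or>
    (\<exists>\<phi> \<gamma>. flip_flop \<O> S1 S2 \<phi> \<and> gauge_aut \<O> S1 S2 \<gamma> \<and>
       ((\<forall>x\<in>carrier \<O>. \<alpha> x = \<phi> (\<gamma> x)) \<or> (\<forall>x\<in>carrier \<O>. \<alpha> x = \<gamma> (\<phi> x))))"
    (is "?L \<longleftrightarrow> ?R")
proof -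
  interpret two_adic_ring Q U S2 S1 \<O> by unfold_locales (use assms in auto)
  interpret O: cstar_algebra \<O> by (rule cstar_\<O>)
  note gens = \<O>_subalgebra(2,3)
  have smult_\<O>: "z \<odot>\<^bsub>\<O>\<^esub> x = z \<odot>\<^bsub>Q\<^esub> x" for z x by (simp add: \<O>_eq)
  have add_\<O>: "x \<oplus>\<^bsub>\<O>\<^esub> y = x \<oplus>\<^bsub>Q\<^esub> y" for x y by (simp add: \<O>_eq)
  obtain M :: "complex ^ 2 ^ 2" where \<alpha>: "\<alpha> \<in> star_aut \<O>" and M: "unitary_matrix M"
    "\<alpha> S1 = (M $ 1 $ 1) \<odot>\<^bsub>Q\<^esub> S1 \<oplus>\<^bsub>Q\<^esub> (M $ 2 $ 1) \<odot>\<^bsub>Q\<^esub> S2"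
    "\<alpha> S2 = (M $ 1 $ 2) \<odot>\<^bsub>Q\<^esub> S1 \<oplus>\<^bsub>Q\<^esub> (M $ 2 $ 2) \<odot>\<^bsub>Q\<^esub> S2"
    using assms(4) unfolding bogoljubov_def smult_\<O> add_\<O> by blast
  have aut_hom: "f \<in> star_hom \<O> \<O>" if "f \<in> star_aut \<O>" for f
    using that unfolding star_aut_def by blast
  show ?thesis
  proof
    assume ?L
    then obtain \<Lambda> where \<Lambda>: "\<Lambda> \<in> star_hom Q Q" "\<And>x. x \<in> carrier \<O> \<Longrightarrow> \<Lambda> x = \<alpha> x" by blast
    show ?R
    proof (cases "\<one>\<^bsub>Q\<^esub> = \<zero>\<^bsub>Q\<^esub>")
      case True
      \<comment> \<open>In the zero algebra every automorphism is the flip-flop.\<close>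
      then have "x = \<zero>\<^bsub>Q\<^esub>" if "x \<in> carrier Q" for x using that l_one l_null by metis
      then have "x = y" if "x \<in> carrier \<O>" "y \<in> carrier \<O>" for x y using that \<O>_subset by blast
      then have "flip_flop \<O> S1 S2 \<alpha>"
        using \<alpha> gens O.star_homD(1)[OF aut_hom[OF \<alpha>]] unfolding flip_flop_def by blast
      then show ?thesis by blast
    next
      case False
      obtain z where z: "cmod z = 1" and "\<alpha> S1 = z \<odot>\<^bsub>Q\<^esub> S1 \<and> \<alpha> S2 = z \<odot>\<^bsub>Q\<^esub> S2 \<or>
          \<alpha> S1 = z \<odot>\<^bsub>Q\<^esub> S2 \<and> \<alpha> S2 = z \<odot>\<^bsub>Q\<^esub> S1"
        using extension_form[OF \<alpha> M \<Lambda> False] by blast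
      then consider "\<alpha> S1 = z \<odot>\<^bsub>Q\<^esub> S1" "\<alpha> S2 = z \<odot>\<^bsub>Q\<^esub> S2" | "\<alpha> S1 = z \<odot>\<^bsub>Q\<^esub> S2" "\<alpha> S2 = z \<odot>\<^bsub>Q\<^esub> S1"
        by blast
      then show ?thesis
      proof cases
        case 1
        then show ?thesis using \<alpha> z unfolding gauge_aut_def smult_\<O> by blast
      next
        case 2
        obtain \<phi> where \<phi>: "flip_flop \<O> S1 S2 \<phi>" "\<And>x. x \<in> carrier \<O> \<Longrightarrow> \<phi> (\<phi> x) = x"
          using flip_flop_exists by blast
        have \<phi>': "\<phi> \<in> star_aut \<O>" "\<phi> S1 = S2" "\<phi> S2 = S1" using \<phi>(1) unfolding flip_flop_def by blast+
        note \<phi>_smult = O.star_homD(5)[OF aut_hom[OF \<phi>'(1)], unfolded smult_\<O>]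
        \<comment> \<open>The flip-flop is an involution, so \<open>\<phi> \<circ> \<alpha>\<close> is the gauge factor of \<open>\<alpha>\<close>.\<close>
        define \<gamma> where "\<gamma> = (\<lambda>x. \<phi> (\<alpha> x))"
        have "\<gamma> \<in> star_aut \<O>" unfolding \<gamma>_def by (rule star_aut_comp[OF cstar_\<O> \<alpha> \<phi>'(1)])
        moreover have "\<gamma> S1 = z \<odot>\<^bsub>Q\<^esub> S1" "\<gamma> S2 = z \<odot>\<^bsub>Q\<^esub> S2"
          using 2 \<phi>' gens \<phi>_smult by (simp_all add: \<gamma>_def)
        ultimately have "gauge_aut \<O> S1 S2 \<gamma>" using z unfolding gauge_aut_def smult_\<O> by blast
        moreover have "\<forall>x\<in>carrier \<O>. \<alpha> x = \<phi> (\<gamma> x)"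
          using \<phi>(2) O.star_homD(1)[OF aut_hom[OF \<alpha>]] by (simp add: \<gamma>_def)
        ultimately show ?thesis using \<phi>(1) by blast
      qed
    qed
  next
    assume ?R
    then consider (flip) "flip_flop \<O> S1 S2 \<alpha>" | (gauge) "gauge_aut \<O> S1 S2 \<alpha>"
      | (both) \<phi> \<gamma> where "flip_flop \<O> S1 S2 \<phi>" "gauge_aut \<O> S1 S2 \<gamma>"
        "(\<forall>x\<in>carrier \<O>. \<alpha> x = \<phi> (\<gamma> x)) \<or> (\<forall>x\<in>carrier \<O>. \<alpha> x = \<gamma> (\<phi> x))"
      by blast
    then show ?L
    proof cases
      case flip
      then have "\<alpha> S1 = 1 \<odot>\<^bsub>Q\<^esub> S2" "\<alpha> S2 = 1 \<odot>\<^bsub>Q\<^esub> S1"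
        using gens_closed by (simp_all add: flip_flop_def smult_one)
      then show ?thesis using antidiagonal_extends[OF \<alpha>, of 1] by simp
    next
      case gauge
      then show ?thesis using diagonal_extends[OF \<alpha>] unfolding gauge_aut_def smult_\<O> by blast
    next
      case both
      then have \<phi>: "\<phi> \<in> star_aut \<O>" "\<phi> S1 = S2" "\<phi> S2 = S1" unfolding flip_flop_def by blast+
      obtain z where z: "cmod z = 1" "\<gamma> S1 = z \<odot>\<^bsub>Q\<^esub> S1" "\<gamma> S2 = z \<odot>\<^bsub>Q\<^esub> S2"
        using both(2) unfolding gauge_aut_def smult_\<O> by blast
      have "\<alpha> S1 = z \<odot>\<^bsub>Q\<^esub> S2" "\<alpha> S2 = z \<odot>\<^bsub>Q\<^esub> S1"
        using both(3) z \<phi> gens O.star_homD(5)[OF aut_hom[OF \<phi>(1)], unfolded smult_\<O>] by auto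
      then show ?thesis using antidiagonal_extends[OF \<alpha> z(1)] by blast
    qed
  qed
qed

end
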